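(* Let $k,r\ge 2$ be integers, let $\Gamma$ be the symmetric graph of type $k$ and order $r$ with vertex set $\mathcal V$ and boundary $\Omega$, and put $Q=(r-1)(k-1)$, $\sigma=k-2$. If $f\in\mathcal D(\mathcal V)^{\sharp}$ is a finitely supported radial function on $\mathcal V$, then its Abel transform is given by $$\mathcal{A}f(\omega,h)= Q^{\frac{|h|}{2}}\,f(|h|)+\sigma\sum_{j\geq 1}Q^{\frac{|h|}{2}+j-1} f(|h|+2j-1)+\frac{r-2}{r-1}\sum_{j\geq 1}Q^{\frac{|h|}{2}+j}\,f(|h|+2j)$$ for all $(\omega,h)\in\Omega\times\mathbb Z$.
   Context: Symmetric graph: $\Gamma$ is a connected graph in which every vertex $v$ belongs to exactly $r$ polygons with $k$ sides each (for $k=2$ a polygon is a single edge), these polygons having no side and no vertex in common except $v$, and such that every nontrivial loop runs through all the edges of at least one polygon. $\mathcal V$ is its vertex set. The distance $d(x,y)$ is the minimal number of polygons crossed by a path connecting $x$ with $y$. Fix an origin $o\in\mathcal V$ and put $|x|=d(x,o)$. Boundary: $\Omega$ is the set of geodesic rays starting at $o$; a ray $\omega$ is identified with its sequence of nodes $\omega_0=o,\omega_1,\omega_2,\dots$ in $\mathcal V$, with $d(\omega_i,\omega_j)=|i-j|$. The Busemann function is $\zeta(x,\omega)=d(o,\omega_m)-d(x,\omega_m)$ for $m>|x|$ (independent of such $m$), and the horocycles are $H_h(\omega)=\{x\in\mathcal V:\zeta(x,\omega)=h\}$ for $h\in\mathbb Z$. Functions: $\mathcal D(\mathcal V)$ is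 the space of finitely supported functions $\mathcal V\to\mathbb C$; a function is radial if it depends only on $|x|$, and then $f(n)$ denotes the common value of $f(x)$ for $|x|=n$; $\mathcal D(\mathcal V)^{\sharp}$ is the subspace of radial functions. Abel transform: for $f\in\mathcal D(\mathcal V)^{\sharp}$, $\mathcal A f(\omega,h)=Q^{h/2}\sum_{x\in H_h(\omega)}f(x)$.
   Formalization: The formal definition of symmetric graph also requires that every edge lie in a polygon and, for k=2, that there be no loops (the graph is a tree); as literally worded, bridges between polygons or 2-gon graphs with cycles would be allowed, and there the formula fails. *)

theory Defs
  imports Complex_Main "HOL-Analysis.Infinite_Sum"
begin

text \<open>A graph is given by its vertex set \<open>V\<close> and its set \<open>E\<close> of edges, an edge being the
  two-element set of its end points.\<close>

definition path_between :: "'a set \<Rightarrow> 'a set set \<Rightarrow> 'a \<Rightarrow> 'a \<Rightarrow> 'a list \<Rightarrow> bool" where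
  "path_between V E x y p \<longleftrightarrow>
     p \<noteq> [] \<and> set p \<subseteq> V \<and> hd p = x \<and> last p = y \<and> successively (\<lambda>u v. {u, v} \<in> E) p"

definition path_edges :: "'a list \<Rightarrow> 'a set set" where
  "path_edges p = {{p ! i, p ! Suc i} |i. Suc i < length p}"

text \<open>Edges of the closed path through the vertices of \<open>c\<close>. If \<open>c\<close> consists of two vertices,
  this is a single edge, in accordance with the convention for \<open>2\<close>-gons.\<close>

definition closed_path_edges :: "'a list \<Rightarrow> 'a set set" where
  "closed_path_edges c = {{c ! i, c ! (Suc i mod length c)} |i. i < length c}"

text \<open>A polygon is represented by its set of sides; \<open>\<Union>P\<close> is the set of its vertices.\<close>

definition polygons :: "'a set set \<Rightarrow> nat \<Rightarrow> 'a set set set" where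
  "polygons E k =
     {closed_path_edges c |c. length c = k \<and> distinct c \<and> closed_path_edges c \<subseteq> E}"

text \<open>Nontrivial loops are taken to be simple. Every closed path that does not reduce to a
  point by deleting backtrackings contains such a loop.\<close>

definition nontrivial_loop :: "'a set set \<Rightarrow> 'a list \<Rightarrow> bool" where
  "nontrivial_loop E c \<longleftrightarrow> length c \<ge> 3 \<and> distinct c \<and> closed_path_edges c \<subseteq> E"

text \<open>\<open>edge_in_polygon\<close> says that the graph is made up of its polygons. Without it, bridges
  joining polygons would be allowed, and a path along a bridge would cross no polygon.

  If \<open>k = 2\<close>, a polygon is a single edge and every loop trivially contains one, so
  \<open>loop_contains_polygon\<close> is void. A 2-gon is to be thought of as the closed path that runs
  along an edge and back, which a simple loop never does: there are no loops, and the graph is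
  the homogeneous tree of degree \<open>r\<close>. This is \<open>no_loop_if_2\<close>.\<close>

locale symmetric_graph =
  fixes V :: "'a set" and E :: "'a set set" and k r :: nat
  assumes edges: "\<And>e. e \<in> E \<Longrightarrow> e \<subseteq> V \<and> card e = 2"
    and connected: "\<And>x y. x \<in> V \<Longrightarrow> y \<in> V \<Longrightarrow> \<exists>p. path_between V E x y p"
    and card_polygons_at: "\<And>v. v \<in> V \<Longrightarrow> card {P \<in> polygons E k. v \<in> \<Union>P} = r"
    and polygons_meet:
      "\<And>v P P'. v \<in> V \<Longrightarrow> P \<in> polygons E k \<Longrightarrow> P' \<in> polygons E k \<Longrightarrow> P \<noteq> P' \<Longrightarrow>
         v \<in> \<Union>P \<Longrightarrow> v \<in> \<Union>P' \<Longrightarrow> P \<inter> P' = {} \<and> \<Union>P \<inter> \<Union>P' = {v}"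
    and edge_in_polygon: "\<And>e. e \<in> E \<Longrightarrow> \<exists>P \<in> polygons E k. e \<in> P"
    and loop_contains_polygon:
      "\<And>c. nontrivial_loop E c \<Longrightarrow> \<exists>P \<in> polygons E k. P \<subseteq> closed_path_edges c"
    and no_loop_if_2: "\<And>c. k = 2 \<Longrightarrow> \<not> nontrivial_loop E c"

definition polygons_crossed :: "'a set set \<Rightarrow> nat \<Rightarrow> 'a list \<Rightarrow> 'a set set set" where
  "polygons_crossed E k p = {P \<in> polygons E k. P \<inter> path_edges p \<noteq> {}}"

definition gdist :: "'a set \<Rightarrow> 'a set set \<Rightarrow> nat \<Rightarrow> 'a \<Rightarrow> 'a \<Rightarrow> nat" where
  "gdist V E k x y =
     (LEAST n. \<exists>p. path_between V E x y p \<and> card (polygons_crossed E k p) = n)"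

text \<open>In what follows \<open>b\<close> is the origin, and \<open>gdist V E k x b\<close> is the length of \<open>x\<close>.\<close>

definition boundary :: "'a set \<Rightarrow> 'a set set \<Rightarrow> nat \<Rightarrow> 'a \<Rightarrow> (nat \<Rightarrow> 'a) set" where
  "boundary V E k b =
     {\<omega>. range \<omega> \<subseteq> V \<and> \<omega> 0 = b \<and>
         (\<forall>i j. int (gdist V E k (\<omega> i) (\<omega> j)) = \<bar>int i - int j\<bar>)}"

definition busemann :: "'a set \<Rightarrow> 'a set set \<Rightarrow> nat \<Rightarrow> 'a \<Rightarrow> 'a \<Rightarrow> (nat \<Rightarrow> 'a) \<Rightarrow> int" where
  "busemann V E k b x \<omega> =
     (THE z. \<forall>m > gdist V E k x b.
        int (gdist V E k b (\<omega> m)) - int (gdist V E k x (\<omega> m)) = z)"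

definition horocycle :: "'a set \<Rightarrow> 'a set set \<Rightarrow> nat \<Rightarrow> 'a \<Rightarrow> (nat \<Rightarrow> 'a) \<Rightarrow> int \<Rightarrow> 'a set" where
  "horocycle V E k b \<omega> h = {x \<in> V. busemann V E k b x \<omega> = h}"

text \<open>Functions on \<open>V\<close> are total functions whose values outside \<open>V\<close> are irrelevant.\<close>

definition finitely_supported :: "'a set \<Rightarrow> ('a \<Rightarrow> complex) set" where
  "finitely_supported V = {f. finite {x \<in> V. f x \<noteq> 0}}"

definition radial :: "'a set \<Rightarrow> 'a set set \<Rightarrow> nat \<Rightarrow> 'a \<Rightarrow> ('a \<Rightarrow> complex) \<Rightarrow> bool" where
  "radial V E k b f \<longleftrightarrow>
     (\<forall>x \<in> V. \<forall>y \<in> V. gdist V E k x b = gdist V E k y b \<longrightarrow> f x = f y)"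

definition radial_value ::
    "'a set \<Rightarrow> 'a set set \<Rightarrow> nat \<Rightarrow> 'a \<Rightarrow> ('a \<Rightarrow> complex) \<Rightarrow> nat \<Rightarrow> complex" where
  "radial_value V E k b f n = (THE c. \<forall>x \<in> V. gdist V E k x b = n \<longrightarrow> f x = c)"

text \<open>Horocycles are infinite in general, hence \<open>infsum\<close>; for finitely supported \<open>f\<close> the sum
  has only finitely many nonzero terms.\<close>

definition abel_transform ::
    "'a set \<Rightarrow> 'a set set \<Rightarrow> nat \<Rightarrow> nat \<Rightarrow> 'a \<Rightarrow> ('a \<Rightarrow> complex) \<Rightarrow> (nat \<Rightarrow> 'a) \<Rightarrow> int \<Rightarrow> complex" where
  "abel_transform V E k r b f \<omega> h =
     of_real (((real r - 1) * (real k - 1)) powr (of_int h / 2)) *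
       (\<Sum>\<^sub>\<infinity>x\<in>horocycle V E k b \<omega> h. f x)"

end

theory Submission imports Defs begin

text \<open>The graph is a tree of polygons. Once the sides of a polygon \<open>P\<close> are deleted, any two vertices
  of \<open>P\<close> lie in different components, so every vertex \<open>x\<close> has a unique gate in \<open>P\<close>, namely the
  vertex of \<open>P\<close> in the component of \<open>x\<close>. The distance of \<open>x\<close> and \<open>y\<close> is then the number of polygons
  in which their gates differ, and every vertex other than the origin lies in exactly one polygon
  that leads back to the origin. Passing from a vertex of length \<open>n\<close> to one of length \<open>n + 1\<close>
  lowers the Busemann function by one, unless it happens inside the polygon through \<open>\<omega> n\<close> and
  \<open>\<omega> (n + 1)\<close>. This yields a recursion for the number of vertices of length \<open>n\<close> on the horocycle
  of index \<open>h\<close>, and the Abel transform of a radial function is the sum of its values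
  weighted with these numbers.\<close>

subsection \<open>Paths and connectivity\<close>

lemma path_edges_simps [simp]:
  "path_edges [] = {}" "path_edges [x] = {}"
  "path_edges (x # y # p) = insert {x, y} (path_edges (y # p))"
proof -
  show "path_edges (x # y # p) = insert {x, y} (path_edges (y # p))"
  proof (intro set_eqI iffI)
    fix e assume "e \<in> path_edges (x # y # p)"
    then obtain i where "e = {(x # y # p) ! i, (x # y # p) ! Suc i}" "Suc i < length (x # y # p)"
      unfolding path_edges_def by blast
    then show "e \<in> insert {x, y} (path_edges (y # p))"
      by (cases i) (auto simp: path_edges_def)
  next
    fix e assume "e \<in> insert {x, y} (path_edges (y # p))"
    then consider "e = {x, y}"
      | i where "e = {(y # p) ! i, (y # p) ! Suc i}" "Suc i < length (y # p)"
      unfolding path_edges_def by blast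
    then show "e \<in> path_edges (x # y # p)"
    proof cases
      case 1
      then show ?thesis unfolding path_edges_def by (auto intro!: exI[of _ 0])
    next
      case (2 i)
      then show ?thesis unfolding path_edges_def by (auto intro!: exI[of _ "Suc i"])
    qed
  qed
qed (simp_all add: path_edges_def)

lemma path_edges_append:
  "path_edges (p @ x # q) = path_edges (p @ [x]) \<union> path_edges (x # q)"
  by (induction p rule: induct_list012) auto

lemma path_edges_rev: "path_edges (rev p) = path_edges p"
proof (induction p rule: induct_list012)
  case (3 x y p)
  have "path_edges (rev (x # y # p)) = path_edges (rev p @ y # [x])" by simp
  also have "\<dots> = path_edges (rev (y # p)) \<union> {{x, y}}"
    by (subst path_edges_append) (auto simp: insert_commute)
  finally show ?case using 3 by auto
qed auto

lemma path_edges_subset_set: "e \<in> path_edges p \<Longrightarrow> e \<subseteq> set p"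
  by (auto simp: path_edges_def)

lemma finite_path_edges: "finite (path_edges p)"
  by (induction p rule: induct_list012) auto

lemma successively_iff_path_edges:
  "successively (\<lambda>u v. {u, v} \<in> F) p \<longleftrightarrow> path_edges p \<subseteq> F"
  by (induction p rule: induct_list012) auto

lemma closed_path_edges_conv_path_edges:
  assumes "c \<noteq> []"
  shows "closed_path_edges c = path_edges (c @ [hd c])"
proof -
  have "{c ! i, c ! (Suc i mod length c)} = {(c @ [hd c]) ! i, (c @ [hd c]) ! Suc i}"
    if "i < length c" for i
  proof (cases "Suc i = length c")
    case True
    then show ?thesis using assms by (simp add: nth_append hd_conv_nth)
  next
    case False
    then show ?thesis using that by (simp add: nth_append)
  qed
  then show ?thesis
    unfolding closed_path_edges_def path_edges_def by (auto; metis)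
qed

lemma Union_closed_path_edges: "\<Union>(closed_path_edges c) = set c"
proof
  show "\<Union>(closed_path_edges c) \<subseteq> set c"
    by (auto simp: closed_path_edges_def intro!: nth_mem mod_less_divisor)
  show "set c \<subseteq> \<Union>(closed_path_edges c)"
  proof
    fix v assume "v \<in> set c"
    then obtain i where "i < length c" "v = c ! i" by (auto simp: in_set_conv_nth)
    then show "v \<in> \<Union>(closed_path_edges c)" unfolding closed_path_edges_def by blast
  qed
qed

text \<open>The sides to the cyclic successor and to the cyclic predecessor of \<open>v\<close>
  serve. From length 3 on they differ; for length 2 they are the same edge.\<close>

lemma closed_path_edges_two_at_vertex:
  assumes "distinct c" "length c \<ge> 3" "v \<in> set c"
  obtains e e' where "e \<in> closed_path_edges c" "e' \<in> closed_path_edges c" "e \<noteq> e'" "v \<in> e" "v \<in> e'"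
proof -
  let ?n = "length c"
  obtain i where i: "i < ?n" "v = c ! i" using assms(3) by (auto simp: in_set_conv_nth)
  define j where "j = (if i = 0 then ?n - 1 else i - 1)"
  have j: "j < ?n" "Suc j mod ?n = i" using i assms(2) unfolding j_def by auto
  define l where "l = Suc i mod ?n"
  have l: "l < ?n" using i unfolding l_def by (metis mod_less_divisor gr_implies_not0 not_gr0)
  have "l = (if Suc i = ?n then 0 else Suc i)" using i unfolding l_def by auto
  then have "l \<noteq> j" "l \<noteq> i" "j \<noteq> i" using i assms(2) unfolding j_def by (auto split: if_splits)
  then have "c ! l \<noteq> c ! j" "c ! l \<noteq> c ! i" "c ! j \<noteq> c ! i"
    using assms(1) i j l by (simp_all add: nth_eq_iff_index_eq)
  then have "{c ! i, c ! l} \<noteq> {c ! j, c ! i}" by (auto simp: doubleton_eq_iff)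
  moreover have "{c ! i, c ! l} \<in> closed_path_edges c" "{c ! j, c ! i} \<in> closed_path_edges c"
    using i j l_def unfolding closed_path_edges_def by blast+
  ultimately show ?thesis using that i by blast
qed

text \<open>The first vertex of a simple path lies on one of its edges only, a vertex of a closed
  path on two. So the first edge of \<open>p\<close> is not in the closed path, and the induction
  passes to the tail.\<close>

lemma closed_path_edges_not_subset_path_edges:
  assumes "distinct c" "length c \<ge> 3" "distinct p"
  shows "\<not> closed_path_edges c \<subseteq> path_edges p"
  using assms(3)
proof (induction p rule: induct_list012)
  case (3 x y p)
  show ?case
  proof
    assume sub: "closed_path_edges c \<subseteq> path_edges (x # y # p)"
    have x: "x \<notin> e" if "e \<in> path_edges (y # p)" for e
      using path_edges_subset_set[OF that] 3 by auto
    have "{x, y} \<notin> closed_path_edges c"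
    proof
      assume "{x, y} \<in> closed_path_edges c"
      then have "x \<in> set c" using Union_closed_path_edges[of c] by blast
      then obtain e e' where "e \<in> closed_path_edges c" "e' \<in> closed_path_edges c" "e \<noteq> e'"
        "x \<in> e" "x \<in> e'"
        using closed_path_edges_two_at_vertex[OF assms(1,2)] by metis
      then show False using sub x by auto
    qed
    then show False using sub 3 by auto
  qed
qed (use assms in \<open>auto simp: closed_path_edges_def intro!: exI[of _ 0]\<close>)

text \<open>Reachability is taken relative to a set of edges, so that deleting a polygon becomes the
  set difference \<open>E - P\<close>.\<close>

definition conn :: "'a set set \<Rightarrow> 'a \<Rightarrow> 'a \<Rightarrow> bool" where
  "conn F = (\<lambda>u v. {u, v} \<in> F)\<^sup>*\<^sup>*"

lemma conn_refl [simp]: "conn F x x"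
  by (simp add: conn_def)

lemma conn_step: "{x, y} \<in> F \<Longrightarrow> conn F x y"
  by (auto simp: conn_def)

lemma conn_trans [trans]: "conn F x y \<Longrightarrow> conn F y z \<Longrightarrow> conn F x z"
  unfolding conn_def by (rule rtranclp_trans)

lemma conn_sym: "conn F x y \<Longrightarrow> conn F y x"
  unfolding conn_def
  by (rule sympD[OF symp_rtranclp]) (auto simp: symp_def insert_commute)

lemma conn_mono: "conn F x y \<Longrightarrow> F \<subseteq> G \<Longrightarrow> conn G x y"
  unfolding conn_def by (erule rtranclp_mono[THEN predicate2D, rotated]) auto

lemma conn_converse_induct [consumes 1, case_names refl step]:
  assumes "conn F x y" "P y"
    "\<And>x z. {x, z} \<in> F \<Longrightarrow> conn F z y \<Longrightarrow> P z \<Longrightarrow> P x"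
  shows "P x"
  using assms unfolding conn_def by (rule converse_rtranclp_induct)

lemma conn_iff_path:
  "conn F x y \<longleftrightarrow> (\<exists>p. p \<noteq> [] \<and> hd p = x \<and> last p = y \<and> path_edges p \<subseteq> F)"
proof
  assume "conn F x y"
  then show "\<exists>p. p \<noteq> [] \<and> hd p = x \<and> last p = y \<and> path_edges p \<subseteq> F"
  proof (induction rule: conn_converse_induct)
    case refl
    show ?case by (rule exI[of _ "[y]"]) simp
  next
    case (step x z)
    then obtain p where "p \<noteq> []" "hd p = z" "last p = y" "path_edges p \<subseteq> F" by blast
    then show ?case using step by (cases p) (auto intro!: exI[of _ "x # p"])
  qed
next
  assume "\<exists>p. p \<noteq> [] \<and> hd p = x \<and> last p = y \<and> path_edges p \<subseteq> F"
  then obtain p where "p \<noteq> []" "hd p = x" "last p = y" "path_edges p \<subseteq> F" by blast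
  then show "conn F x y"
  proof (induction p arbitrary: x rule: induct_list012)
    case (3 a c p)
    then have "conn F c y" "{x, c} \<in> F" by auto
    then show ?case by (metis conn_step conn_trans)
  qed auto
qed

text \<open>Stop the walk at its first point in \<open>A\<close>: each edge used has an end outside
  \<open>A\<close>. If \<open>A\<close> is the vertex set of a polygon, such an edge is not a side
  of it.\<close>

lemma conn_first_visit:
  assumes "conn F x y" "y \<in> A"
  obtains z where "z \<in> A" "conn {e \<in> F. \<not> e \<subseteq> A} x z"
proof -
  have "\<exists>z\<in>A. conn {e \<in> F. \<not> e \<subseteq> A} x z"
    using assms
  proof (induction rule: conn_converse_induct)
    case refl
    then show ?case by (intro bexI[of _ y]) simp_all
  next
    case (step x z)
    show ?case
    proof (cases "x \<in> A")
      case True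
      then show ?thesis by (intro bexI[of _ x]) simp_all
    next
      case False
      then have "conn {e \<in> F. \<not> e \<subseteq> A} x z" using step by (intro conn_step) auto
      moreover obtain w where "w \<in> A" "conn {e \<in> F. \<not> e \<subseteq> A} z w" using step by blast
      ultimately show ?thesis by (intro bexI[of _ w]) (rule conn_trans)
    qed
  qed
  then show ?thesis using that by blast
qed

text \<open>Cut the walk just before its first edge in \<open>P\<close>; the point reached is an end
  of that edge.\<close>

lemma conn_avoid_or_visit:
  assumes "conn F x y"
  shows "conn (F - P) x y \<or> (\<exists>z\<in>\<Union>P. conn (F - P) x z)"
  using assms
proof (induction rule: conn_converse_induct)
  case (step x z)
  show ?case
  proof (cases "{x, z} \<in> P")
    case True
    then have "x \<in> \<Union>P" by blast
    then show ?thesis by (intro disjI2 bexI[of _ x]) simp_all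
  next
    case False
    then have "conn (F - P) x z" using step by (intro conn_step) auto
    then have "conn (F - P) x w" if "conn (F - P) z w" for w using that by (rule conn_trans)
    then show ?thesis using step.IH by blast
  qed
qed simp

text \<open>Cut the walk at its first arrival at \<open>v\<close>; \<open>u\<close> is the point
  before.\<close>

lemma conn_last_step:
  assumes "conn F x v" "x \<noteq> v"
  obtains u where "{u, v} \<in> F" "conn {e \<in> F. v \<notin> e} x u"
proof -
  have "\<exists>u. {u, v} \<in> F \<and> conn {e \<in> F. v \<notin> e} x u"
    using assms
  proof (induction rule: conn_converse_induct)
    case (step x z)
    show ?case
    proof (cases "z = v")
      case True
      then show ?thesis using step conn_refl by metis
    next
      case False
      then have "conn {e \<in> F. v \<notin> e} x z" using step by (intro conn_step) auto
      then show ?thesis using step False by (meson conn_trans)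
    qed
  qed simp
  then show ?thesis using that by blast
qed

lemma conn_in_Union: "conn F x y \<Longrightarrow> x = y \<or> y \<in> \<Union>F"
  unfolding conn_def by (erule rtranclp.cases) auto

lemma conn_closed_path_edges:
  assumes "x \<in> set c" "y \<in> set c"
  shows "conn (closed_path_edges c) x y"
proof -
  have *: "conn (closed_path_edges c) (c ! 0) (c ! i)" if "i < length c" for i
    using that
  proof (induction i)
    case (Suc i)
    then have "{c ! i, c ! Suc i} \<in> closed_path_edges c"
      unfolding closed_path_edges_def by (auto intro!: exI[of _ i])
    then show ?case using Suc by (metis conn_step conn_trans Suc_lessD)
  qed simp
  then show ?thesis using assms by (metis in_set_conv_nth conn_sym conn_trans)
qed

subsection \<open>Gates and distances\<close>

locale polygonal_graph = symmetric_graph V E k r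
  for V :: "'a set" and E :: "'a set set" and k r :: nat +
  assumes k_ge_2: "k \<ge> 2" and r_ge_2: "r \<ge> 2"
begin

abbreviation "polys \<equiv> polygons E k"

section \<open>Polygons, their arcs, and the loops through them\<close>

lemma polygonE:
  assumes "P \<in> polys"
  obtains c where "length c = k" "distinct c" "P = closed_path_edges c" "closed_path_edges c \<subseteq> E"
  using assms unfolding polygons_def by blast

lemma polygon_subset: "P \<in> polys \<Longrightarrow> P \<subseteq> E"
  by (auto elim: polygonE)

lemma polygon_vertices: "P \<in> polys \<Longrightarrow> \<Union>P \<subseteq> V"
  using polygon_subset edges by blast

lemma card_polygon_vertices: "P \<in> polys \<Longrightarrow> card (\<Union>P) = k"
  by (erule polygonE) (simp add: Union_closed_path_edges distinct_card)

lemma finite_polygon_vertices: "P \<in> polys \<Longrightarrow> finite (\<Union>P)"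
  by (erule polygonE) (simp add: Union_closed_path_edges)

lemma polygon_vertices_nonempty: "P \<in> polys \<Longrightarrow> \<Union>P \<noteq> {}"
  using card_polygon_vertices[of P] k_ge_2 by fastforce

lemma polygon_connected:
  assumes "P \<in> polys" "x \<in> \<Union>P" "y \<in> \<Union>P"
  shows "conn P x y"
  using assms(1)
proof (rule polygonE)
  fix c assume "P = closed_path_edges c"
  then show ?thesis using assms(2,3) Union_closed_path_edges[of c] conn_closed_path_edges[of x c y] by simp
qed

lemma polygons_disjoint:
  assumes "P \<in> polys" "P' \<in> polys" "P \<noteq> P'"
  shows "P \<inter> P' = {}"
proof (rule ccontr)
  assume "P \<inter> P' \<noteq> {}"
  then obtain e where e: "e \<in> P" "e \<in> P'" by blast
  then have "e \<subseteq> V" "card e = 2" using edges polygon_subset assms by blast+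
  then obtain v where "v \<in> e" by fastforce
  then have "v \<in> V" "v \<in> \<Union>P" "v \<in> \<Union>P'" using e \<open>e \<subseteq> V\<close> by auto
  then show False using polygons_meet[of v P P'] assms e by auto
qed

text \<open>The arc through consecutive entries of \<open>c\<close> omits the closing side from
  \<open>c ! (k - 1)\<close> to \<open>c ! 0\<close>, hence is a proper part of \<open>P\<close>.
  Its direction depends on the order of the indices, so its ends are given as an unordered
  pair.\<close>

lemma polygon_arc:
  assumes "P \<in> polys" "x \<in> \<Union>P" "y \<in> \<Union>P" "x \<noteq> y" "k \<ge> 3"
  obtains a where "a \<noteq> []" "distinct a" "set a \<subseteq> \<Union>P" "path_edges a \<subset> P"
    "{hd a, last a} = {x, y}"
proof -
  obtain c where c: "length c = k" "distinct c" "P = closed_path_edges c"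
    using assms(1) by (rule polygonE)
  have "\<Union>P = set c" using Union_closed_path_edges[of c] c by simp
  then obtain i' j' where ij': "i' < k" "j' < k" "x = c ! i'" "y = c ! j'"
    using assms c(1) by (auto simp: in_set_conv_nth)
  then have "i' < j' \<or> j' < i'" using assms(4) by (cases i' j' rule: linorder_cases) auto
  then obtain i j where ij: "i < j" "j < k" "{c ! i, c ! j} = {x, y}"
    using ij' by (auto simp: insert_commute)
  define a where "a = take (Suc (j - i)) (drop i c)"
  have len: "length a = Suc (j - i)" using ij c unfolding a_def by simp
  have nth: "a ! l = c ! (i + l)" if "l \<le> j - i" for l using that ij c unfolding a_def by simp
  have "path_edges a \<subseteq> P - {{c ! (k - 1), c ! 0}}"
  proof
    fix e assume "e \<in> path_edges a"
    then obtain l where "Suc l < length a" and l: "e = {a ! l, a ! Suc l}"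
      unfolding path_edges_def by blast
    then have "Suc l \<le> j - i" using len by simp
    then have e: "e = {c ! (i + l), c ! Suc (i + l)}" "Suc (i + l) < k" using nth l \<open>Suc l \<le> j - i\<close> ij by auto
    then have "e \<in> P" unfolding c closed_path_edges_def using c(1)
      by (auto intro!: exI[of _ "i + l"])
    \<comment> \<open>Two consecutive indices below \<open>k\<close> can be \<open>0\<close> and
      \<open>k - 1\<close> only for \<open>k = 2\<close>.\<close>
    moreover have "e \<noteq> {c ! (k - 1), c ! 0}"
      using e c assms(5) by (auto simp: doubleton_eq_iff nth_eq_iff_index_eq)
    ultimately show "e \<in> P - {{c ! (k - 1), c ! 0}}" by blast
  qed
  moreover have "Suc (k - 1) mod length c = 0" "k - 1 < length c" using c(1) k_ge_2 by auto
  then have "{c ! (k - 1), c ! 0} \<in> P"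
    unfolding c closed_path_edges_def by (metis (mono_tags, lifting) mem_Collect_eq)
  ultimately have "path_edges a \<subset> P" by blast
  moreover have "a \<noteq> []" using len by auto
  moreover have "hd a = c ! i" "last a = c ! j" using nth[of 0] nth[of "j - i"] len ij
    by (simp_all add: hd_conv_nth last_conv_nth \<open>a \<noteq> []\<close>)
  moreover have "distinct a" using c unfolding a_def by simp
  moreover have "set a \<subseteq> \<Union>P" unfolding \<open>\<Union>P = set c\<close> a_def
    by (meson order_trans set_drop_subset set_take_subset)
  ultimately show ?thesis using that ij by metis
qed

text \<open>The loop must contain a polygon. It is not \<open>P\<close>, as \<open>a\<close> is a
  proper part and \<open>p\<close> avoids \<open>P\<close>; being disjoint from \<open>P\<close>, it
  lies in the simple path \<open>p\<close>, which contains no closed path.\<close>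

lemma polygon_in_loop:
  assumes "P \<in> polys" "path_edges a \<subset> P" "distinct p" "path_edges p \<inter> P = {}"
    "nontrivial_loop E c" "closed_path_edges c = path_edges a \<union> path_edges p"
  shows False
proof -
  have k3: "k \<ge> 3" using no_loop_if_2 assms(5) k_ge_2 by (cases "k = 2") auto
  obtain P' where P': "P' \<in> polys" "P' \<subseteq> path_edges a \<union> path_edges p"
    using loop_contains_polygon assms(5,6) by metis
  have "P' \<noteq> P" using P' assms by blast
  then have "P' \<subseteq> path_edges p" using polygons_disjoint[OF P'(1) assms(1)] P' assms(2) by blast
  then show False using P'(1) closed_path_edges_not_subset_path_edges[OF _ _ assms(3)] k3
    by (metis polygonE)
qed

text \<open>Take a shortest path among those between any two distinct points of \<open>U\<close>. A
  repeated vertex could be cut out, and at an inner point of \<open>U\<close> the path could be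
  truncated.\<close>

lemma shortest_chord:
  assumes "conn F x y" "x \<in> U" "y \<in> U" "x \<noteq> y"
  obtains p where "distinct p" "p \<noteq> []" "path_edges p \<subseteq> F" "hd p \<noteq> last p"
    "hd p \<in> U" "last p \<in> U" "\<And>w. w \<in> set p \<Longrightarrow> w \<in> U \<Longrightarrow> w = hd p \<or> w = last p"
proof -
  let ?C = "\<lambda>p. p \<noteq> [] \<and> path_edges p \<subseteq> F \<and> hd p \<noteq> last p \<and> hd p \<in> U \<and> last p \<in> U"
  define p where "p = arg_min length ?C"
  have "\<exists>p. ?C p" using assms unfolding conn_iff_path by blast
  then have p: "?C p" and min: "\<And>q. ?C q \<Longrightarrow> length p \<le> length q"
    unfolding p_def using arg_min_nat_lemma[of ?C _ length] by blast+
  have "distinct p"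
  proof (rule ccontr)
    assume "\<not> distinct p"
    then obtain xs ys zs w where d: "p = xs @ [w] @ ys @ [w] @ zs"
      using not_distinct_decomp by blast
    have "path_edges p = path_edges (xs @ [w]) \<union> path_edges (w # ys @ [w]) \<union> path_edges (w # zs)"
      using path_edges_append[of xs w "ys @ [w] @ zs"] path_edges_append[of "w # ys" w zs]
      unfolding d by auto
    then have "path_edges (xs @ w # zs) \<subseteq> path_edges p"
      by (subst path_edges_append) blast
    moreover have "hd (xs @ w # zs) = hd p" "last (xs @ w # zs) = last p"
      unfolding d by (simp_all add: hd_append)
    ultimately have "?C (xs @ w # zs)" using p by auto
    then show False using min[of "xs @ w # zs"] d by simp
  qed
  moreover have "w = hd p \<or> w = last p" if w: "w \<in> set p" "w \<in> U" for w
  proof (rule ccontr)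
    assume nw: "\<not> (w = hd p \<or> w = last p)"
    obtain xs zs where d: "p = xs @ w # zs" using w split_list by metis
    then have "zs \<noteq> []" using nw by auto
    have "path_edges (xs @ [w]) \<subseteq> path_edges p"
      unfolding d by (subst (2) path_edges_append) blast
    moreover have "hd (xs @ [w]) = hd p" "last (xs @ [w]) = w"
      unfolding d by (simp_all add: hd_append)
    ultimately have "?C (xs @ [w])" using p nw w by auto
    then show False using min[of "xs @ [w]"] d \<open>zs \<noteq> []\<close> by simp
  qed
  ultimately show ?thesis using that p by blast
qed

text \<open>A path leaving a polygon and returning to it elsewhere would, together with an arc of the
  polygon, form a loop that contains no polygon.\<close>

lemma polygon_separates:
  assumes "P \<in> polys" "x \<in> \<Union>P" "y \<in> \<Union>P" "conn (E - P) x y"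
  shows "x = y"
proof (rule ccontr)
  assume "x \<noteq> y"
  then obtain p where p: "distinct p" "p \<noteq> []" "path_edges p \<subseteq> E - P" "hd p \<noteq> last p"
    "hd p \<in> \<Union>P" "last p \<in> \<Union>P" "\<And>w. w \<in> set p \<Longrightarrow> w \<in> \<Union>P \<Longrightarrow> w = hd p \<or> w = last p"
    using shortest_chord[of "E - P" x y "\<Union>P"] assms by metis
  \<comment> \<open>Here \<open>a\<close> leads from the end of \<open>q\<close> back to its start,
    so the two close up. The other orientation of the arc is covered by reversing
    \<open>p\<close>.\<close>
  have *: False if a: "distinct a" "set a \<subseteq> \<Union>P" "path_edges a \<subset> P" "a \<noteq> []"
    and q: "distinct q" "q \<noteq> []" "path_edges q \<subseteq> E - P"
      "\<And>w. w \<in> set q \<Longrightarrow> w \<in> \<Union>P \<Longrightarrow> w = hd q \<or> w = last q"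
    and aq: "hd a = last q" "last a = hd q" "last q \<noteq> hd q" for a q
  proof -
    \<comment> \<open>\<open>m\<close> is the interior of \<open>q\<close>, so \<open>a @ m\<close>
      lists every vertex of the loop once.\<close>
    define m where "m = butlast (tl q)"
    have q_eq: "q = hd q # m @ [last q]"
      using q aq unfolding m_def by (cases q) (auto simp: butlast_append)
    have a_eq: "a = butlast a @ [hd q]" using a aq by (metis append_butlast_last_id)
    have "butlast a \<noteq> []" using a aq by (cases a) auto
    define c where "c = a @ m"
    have "hd c = last q" using a aq unfolding c_def by simp
    then have "closed_path_edges c = path_edges (c @ [last q])"
      using a by (metis append_is_Nil_conv c_def closed_path_edges_conv_path_edges)
    also have "c @ [last q] = butlast a @ hd q # m @ [last q]"
      unfolding c_def using a_eq by (metis append.assoc append_Cons append_Nil)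
    also have "path_edges \<dots> = path_edges a \<union> path_edges q"
      using path_edges_append[of "butlast a" "hd q" "m @ [last q]"] q_eq a_eq by metis
    finally have c: "closed_path_edges c = path_edges a \<union> path_edges q" .
    have "distinct (hd q # m @ [last q])" using q(1) q_eq by metis
    then have m: "distinct m" "hd q \<notin> set m" "last q \<notin> set m" by auto
    have "set m \<subseteq> set q" using q_eq by (metis set_subset_Cons set_append Un_upper1 order_trans)
    then have "set a \<inter> set m = {}" using a(2) q(4) m by blast
    then have "distinct c" using a m unfolding c_def by simp
    moreover have "length c \<ge> 3"
    proof (rule ccontr)
      \<comment> \<open>Then arc and path would be the same single edge, lying both in
        \<open>P\<close> and outside of it.\<close>
      assume "\<not> length c \<ge> 3"
      moreover have "length a \<ge> 2" using \<open>butlast a \<noteq> []\<close>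
        by (cases a; cases "tl a") auto
      ultimately have "length m = 0" "length a = 2" unfolding c_def length_append by linarith+
      then have "m = []" by simp
      then have "length (butlast a) = Suc 0" using \<open>length a = 2\<close> by simp
      then obtain u where "butlast a = [u]" by (metis length_0_conv length_Suc_conv)
      then have "a = [u, hd q]" using a_eq by simp
      then have "a = [last q, hd q]" using aq(1) by (metis list.sel(1))
      moreover have "q = [hd q, last q]" using q_eq \<open>m = []\<close> by simp
      ultimately have "path_edges a = path_edges [last q, hd q]" "path_edges q = path_edges [hd q, last q]"
        by metis+
      then show False using a(3) q(3) by (auto simp: insert_commute)
    qed
    moreover have "closed_path_edges c \<subseteq> E"
      using c a(3) q(3) polygon_subset[OF assms(1)] by blast
    ultimately have "nontrivial_loop E c" unfolding nontrivial_loop_def by simp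
    then show False using polygon_in_loop[OF assms(1) a(3) q(1) _ _ c] q(3) by blast
  qed
  show False
  proof (cases "k = 2")
    \<comment> \<open>A 2-gon has no proper arc between its two vertices. Instead, \<open>p\<close>
      is closed up by the only edge of \<open>P\<close>, and \<open>no_loop_if_2\<close> excludes
      the resulting loop.\<close>
    case True
    have "card (\<Union>P) = 2" using card_polygon_vertices assms True by simp
    moreover have "{hd p, last p} \<subseteq> \<Union>P" "card {hd p, last p} = 2" using p by auto
    ultimately have "\<Union>P = {hd p, last p}"
      using finite_polygon_vertices[OF assms(1)] by (metis card_subset_eq)
    obtain c where c: "length c = k" "distinct c" "P = closed_path_edges c"
      using assms(1) by (rule polygonE)
    then obtain u v where uv: "c = [u, v]" using True
      by (metis One_nat_def Suc_1 length_0_conv length_Suc_conv)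
    have Puv: "P = path_edges ([u, v] @ [u])" unfolding c(3) uv by (simp add: closed_path_edges_conv_path_edges)
    then have P1: "P = {{hd p, last p}}" using \<open>\<Union>P = _\<close> by (auto simp: insert_commute)
    have "length p \<ge> 3"
    proof (rule ccontr)
      assume "\<not> length p \<ge> 3"
      then have "p = [hd p, last p]" using p(2,4)
        by (cases p; cases "tl p"; cases "tl (tl p)") auto
      then have "{hd p, last p} \<in> path_edges p" by (metis insertI1 path_edges_simps(3))
      then show False using p P1 by blast
    qed
    moreover have "closed_path_edges p \<subseteq> E"
    proof -
      have "closed_path_edges p = path_edges (butlast p @ last p # [hd p])"
        using p(2) closed_path_edges_conv_path_edges by (metis append_butlast_last_id append.assoc append_Cons append_Nil)
      also have "\<dots> = path_edges p \<union> {{hd p, last p}}"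
        using p(2) by (subst path_edges_append) (simp add: insert_commute)
      finally show ?thesis using p P1 polygon_subset assms by blast
    qed
    ultimately show False using no_loop_if_2[OF True, of p] p(1) unfolding nontrivial_loop_def by blast
  next
    case False
    then have "k \<ge> 3" using k_ge_2 by simp
    then obtain a where a: "a \<noteq> []" "distinct a" "set a \<subseteq> \<Union>P" "path_edges a \<subset> P"
      "{hd a, last a} = {hd p, last p}"
      using polygon_arc[OF assms(1) p(5,6,4)] by metis
    then consider "hd a = hd p" "last a = last p" | "hd a = last p" "last a = hd p"
      by (auto simp: doubleton_eq_iff)
    then show False
    proof cases
      case 1
      show ?thesis
        by (rule *[of a "rev p"])
          (use a p 1 in \<open>auto simp: path_edges_rev hd_rev last_rev\<close>)
    next
      case 2
      show ?thesis by (rule *[of a p]) (use a p 2 in auto)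
    qed
  qed
qed

text \<open>By \<open>pdist_polygon\<close> this is also the vertex of \<open>P\<close> nearest to
  \<open>x\<close>, for \<open>x\<close> in \<open>V\<close>.\<close>

definition gate :: "'a set set \<Rightarrow> 'a \<Rightarrow> 'a" where
  "gate P x = (THE z. z \<in> \<Union>P \<and> conn (E - P) x z)"

lemma connected_conn: "x \<in> V \<Longrightarrow> y \<in> V \<Longrightarrow> conn E x y"
  using connected[of x y]
  unfolding conn_iff_path path_between_def successively_iff_path_edges by blast

lemma gate_eqI:
  assumes "P \<in> polys" "z \<in> \<Union>P" "conn (E - P) x z"
  shows "gate P x = z"
  unfolding gate_def
proof (rule the_equality)
  fix w assume "w \<in> \<Union>P \<and> conn (E - P) x w"
  then show "w = z" using polygon_separates[OF assms(1), of w z] assms conn_sym conn_trans by metis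
qed (use assms in blast)

text \<open>A walk from \<open>x\<close> to \<open>P\<close>, stopped at its first vertex of
  \<open>P\<close>, has used no side of \<open>P\<close>.\<close>

lemma
  assumes "P \<in> polys" "x \<in> V"
  shows gate_in_polygon: "gate P x \<in> \<Union>P" and conn_gate: "conn (E - P) x (gate P x)"
proof -
  obtain y where y: "y \<in> \<Union>P" using polygon_vertices_nonempty assms by blast
  then have "conn E x y" using connected_conn polygon_vertices assms by blast
  from conn_first_visit[OF this y] obtain z where z: "z \<in> \<Union>P" "conn {e \<in> E. \<not> e \<subseteq> \<Union>P} x z" .
  then have "conn (E - P) x z" by (elim conn_mono) blast
  then have "gate P x = z" using gate_eqI assms z by blast
  then show "gate P x \<in> \<Union>P" "conn (E - P) x (gate P x)"
    using z \<open>conn (E - P) x z\<close> by simp_all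
qed

lemma gate_of_vertex: "P \<in> polys \<Longrightarrow> x \<in> \<Union>P \<Longrightarrow> gate P x = x"
  by (rule gate_eqI) simp_all

lemma gate_cong:
  assumes "P \<in> polys" "y \<in> V" "conn (E - P) x y"
  shows "gate P x = gate P y"
  using gate_eqI[OF assms(1)] gate_in_polygon conn_gate conn_trans assms by metis

text \<open>Polygons share no sides, so \<open>R\<close> stays connected when \<open>P\<close> is
  deleted.\<close>

lemma gate_eq_if_other_polygon:
  assumes "P \<in> polys" "R \<in> polys" "P \<noteq> R" "x \<in> \<Union>R" "y \<in> \<Union>R"
  shows "gate P x = gate P y"
proof (rule gate_cong)
  show "y \<in> V" using assms polygon_vertices by blast
  have "R \<subseteq> E - P" using polygons_disjoint[of P R] polygon_subset assms by blast
  then show "conn (E - P) x y" using polygon_connected[of R x y] conn_mono assms by metis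
qed (fact assms)

text \<open>At most one polygon at \<open>v\<close> leads towards \<open>x\<close>: a walk from
  \<open>x\<close> that first meets the two polygons in \<open>P'\<close> has avoided
  \<open>P\<close>, and from there \<open>v\<close> is reached within \<open>P'\<close>, so the gate
  in \<open>P\<close> is \<open>v\<close>.\<close>

lemma gate_at_shared_vertex:
  assumes "P \<in> polys" "P' \<in> polys" "P \<noteq> P'" "v \<in> \<Union>P" "v \<in> \<Union>P'" "x \<in> V"
  shows "gate P x = v \<or> gate P' x = v"
proof -
  have v: "v \<in> V" using polygon_vertices assms by blast
  have "conn E x v" "v \<in> \<Union>P \<union> \<Union>P'" using connected_conn v assms by auto
  from conn_first_visit[OF this] obtain z where z: "z \<in> \<Union>P \<union> \<Union>P'"
    "conn {e \<in> E. \<not> e \<subseteq> \<Union>P \<union> \<Union>P'} x z" .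
  have *: "gate R x = v"
    if R: "R \<in> {P, P'}" "R' \<in> {P, P'}" "R \<noteq> R'" "z \<in> \<Union>R'" for R R'
  proof -
    have "gate R x = gate R z"
    proof (rule gate_cong)
      show "conn (E - R) x z" by (rule conn_mono[OF z(2)]) (use R in blast)
      show "z \<in> V" "R \<in> polys" using R polygon_vertices assms by auto
    qed
    also have "\<dots> = gate R v"
      by (rule gate_eq_if_other_polygon[of R R']) (use R assms in auto)
    also have "\<dots> = v" using gate_of_vertex R assms by auto
    finally show ?thesis .
  qed
  show ?thesis using z(1) *[of P' P] *[of P P'] assms(3) by auto
qed

text \<open>Take the polygon containing the edge by which a walk from \<open>x\<close> first arrives
  at \<open>v\<close>.\<close>

lemma exists_polygon_towards:
  assumes "x \<in> V" "v \<in> V" "x \<noteq> v"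
  obtains P where "P \<in> polys" "v \<in> \<Union>P" "gate P x \<noteq> v"
proof -
  have "conn E x v" using connected_conn assms by blast
  from conn_last_step[OF this assms(3)] obtain u where
    u: "{u, v} \<in> E" "conn {e \<in> E. v \<notin> e} x u" .
  then obtain P where P: "P \<in> polys" "{u, v} \<in> P" using edge_in_polygon by blast
  then have "u \<in> \<Union>P" by blast
  from conn_first_visit[OF u(2) this] obtain z where
    z: "z \<in> \<Union>P" "conn {e \<in> {e \<in> E. v \<notin> e}. \<not> e \<subseteq> \<Union>P} x z" .
  \<comment> \<open>Either \<open>z\<close> is \<open>x\<close>, or it lies on an edge that avoids
    \<open>v\<close>.\<close>
  have "z \<noteq> v" using conn_in_Union[OF z(2)] assms(3) by auto
  moreover have "gate P x = z" by (rule gate_eqI[OF P(1) z(1)], rule conn_mono[OF z(2)]) blast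
  ultimately show ?thesis using that P by blast
qed

section \<open>Separating polygons and the distance\<close>

text \<open>These are the polygons that every path from \<open>x\<close> to \<open>y\<close> has to cross.\<close>

definition separating :: "'a \<Rightarrow> 'a \<Rightarrow> 'a set set set" where
  "separating x y = {P \<in> polys. gate P x \<noteq> gate P y}"

text \<open>Choosing a crossed side in each polygon is injective, since polygons share no sides.
  Finiteness matters because \<open>card\<close> of an infinite set is 0.\<close>

lemma finite_polygons_crossed: "finite (polygons_crossed E k p)"
proof -
  let ?f = "\<lambda>P. SOME e. e \<in> P \<inter> path_edges p"
  have f: "?f P \<in> P \<inter> path_edges p" if "P \<in> polygons_crossed E k p" for P
  proof -
    have "\<exists>e. e \<in> P \<inter> path_edges p" using that unfolding polygons_crossed_def by blast
    then show ?thesis by (rule someI_ex)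
  qed
  have "inj_on ?f (polygons_crossed E k p)"
  proof (rule inj_onI)
    fix P P' assume a: "P \<in> polygons_crossed E k p" "P' \<in> polygons_crossed E k p" "?f P = ?f P'"
    then have "?f P \<in> P \<inter> P'" using f[OF a(1)] f[OF a(2)] by auto
    then show "P = P'" using polygons_disjoint[of P P'] a unfolding polygons_crossed_def by blast
  qed
  moreover have "?f ` polygons_crossed E k p \<subseteq> path_edges p" using f by blast
  ultimately show ?thesis by (meson finite_imageD finite_path_edges finite_subset)
qed

text \<open>A path using no side of \<open>P\<close> stays in one component of \<open>E - P\<close>
  and keeps its gate. This bounds the distance from below.\<close>

lemma separating_subset_crossed:
  assumes "path_between V E x y p"
  shows "separating x y \<subseteq> polygons_crossed E k p"
proof
  fix P assume P: "P \<in> separating x y"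
  have p: "p \<noteq> []" "hd p = x" "last p = y" "path_edges p \<subseteq> E" "y \<in> V"
    using assms unfolding path_between_def successively_iff_path_edges by auto
  have "path_edges p \<inter> P \<noteq> {}"
  proof
    assume "path_edges p \<inter> P = {}"
    then have "conn (E - P) x y" unfolding conn_iff_path using p by blast
    then show False using gate_cong P p(5) unfolding separating_def by blast
  qed
  then show "P \<in> polygons_crossed E k p"
    using P unfolding polygons_crossed_def separating_def by blast
qed

text \<open>If \<open>P\<close> were unavoidable, both ends would reach \<open>P\<close> without
  using its sides, and do so at their gates. These coincide, so the two walks join to one that
  avoids \<open>P\<close>.\<close>

lemma conn_avoid_nonseparating:
  assumes "conn F x y" "F \<subseteq> E" "P \<in> polys" "gate P x = gate P y"
  shows "conn (F - P) x y"
proof (rule ccontr)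
  assume n: "\<not> conn (F - P) x y"
  have FE: "conn (E - P) u w" if "conn (F - P) u w" for u w
    using that assms(2) by (elim conn_mono) blast
  obtain z where z: "z \<in> \<Union>P" "conn (F - P) x z" using conn_avoid_or_visit assms(1) n by metis
  obtain w where w: "w \<in> \<Union>P" "conn (F - P) y w"
    using conn_avoid_or_visit[OF conn_sym[OF assms(1)], of P] n conn_sym by metis
  have "gate P x = z" "gate P y = w" using gate_eqI assms(3) z w FE by blast+
  then have "z = w" using assms by simp
  then show False using n z w conn_sym conn_trans by metis
qed

text \<open>Start from the polygons crossed by any path, which cover it by
  \<open>edge_in_polygon\<close>, and discard the non-separating ones one at a time.\<close>

lemma conn_separating:
  assumes "x \<in> V" "y \<in> V"
  shows "conn (\<Union>(separating x y)) x y"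
proof -
  obtain p where p: "path_between V E x y p" using connected assms by blast
  have "conn (path_edges p) x y"
    using p unfolding conn_iff_path path_between_def by blast
  moreover have "path_edges p \<subseteq> \<Union>(polygons_crossed E k p)"
  proof
    fix e assume "e \<in> path_edges p"
    moreover from this have "e \<in> E"
      using p unfolding path_between_def successively_iff_path_edges by blast
    ultimately show "e \<in> \<Union>(polygons_crossed E k p)"
      using edge_in_polygon unfolding polygons_crossed_def by blast
  qed
  ultimately have "conn (\<Union>(polygons_crossed E k p)) x y" by (rule conn_mono)
  moreover have "conn (\<Union>(S \<inter> separating x y)) x y"
    if "finite S" "conn (\<Union>S) x y" "S \<subseteq> polys" for S
  proof -
    have "conn (\<Union>S - \<Union>T) x y" if "finite T" "T \<subseteq> S - separating x y" for T
      using that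
    proof (induction T rule: finite_induct)
      case (insert P T)
      have P: "P \<in> polys" "gate P x = gate P y"
        using insert \<open>S \<subseteq> polys\<close> unfolding separating_def by auto
      have "\<Union>S - \<Union>T \<subseteq> E" using \<open>S \<subseteq> polys\<close> polygon_subset by blast
      moreover have "conn (\<Union>S - \<Union>T) x y" using insert by simp
      ultimately have "conn (\<Union>S - \<Union>T - P) x y"
        using P conn_avoid_nonseparating by blast
      moreover have "\<Union>S - \<Union>T - P = \<Union>S - \<Union>(insert P T)" by auto
      ultimately show ?case by simp
    qed (use \<open>conn (\<Union>S) x y\<close> in simp)
    from this[of "S - separating x y"] \<open>finite S\<close>
    have "conn (\<Union>S - \<Union>(S - separating x y)) x y" by simp
    then show ?thesis by (rule conn_mono) blast
  qed
  ultimately have "conn (\<Union>(polygons_crossed E k p \<inter> separating x y)) x y"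
    using finite_polygons_crossed unfolding polygons_crossed_def by (metis (no_types, lifting) mem_Collect_eq subsetI)
  then show ?thesis by (rule conn_mono) blast
qed

lemma finite_separating: "x \<in> V \<Longrightarrow> y \<in> V \<Longrightarrow> finite (separating x y)"
  by (meson connected finite_polygons_crossed finite_subset separating_subset_crossed)

abbreviation "pdist \<equiv> gdist V E k"

text \<open>A path inside the separating polygons crosses no others, by disjointness of sides, so
  the lower bound is attained.\<close>

lemma pdist_eq_card_separating:
  assumes "x \<in> V" "y \<in> V"
  shows "pdist x y = card (separating x y)"
  unfolding gdist_def
proof (rule Least_equality)
  obtain p where p: "p \<noteq> []" "hd p = x" "last p = y" "path_edges p \<subseteq> \<Union>(separating x y)"
    using conn_separating[OF assms] unfolding conn_iff_path by blast
  have "path_edges p \<subseteq> E" using p(4) polygon_subset unfolding separating_def by blast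
  \<comment> \<open>Each vertex of \<open>p\<close> is reached from \<open>x\<close> by an initial
    piece, so it is \<open>x\<close> or lies on an edge.\<close>
  moreover have "set p \<subseteq> V"
  proof
    fix w assume "w \<in> set p"
    then obtain xs ys where "p = xs @ w # ys" using split_list by metis
    then have "path_edges (xs @ [w]) \<subseteq> E" "hd (xs @ [w]) = x"
      using \<open>path_edges p \<subseteq> E\<close> path_edges_append[of xs w ys] p by (auto simp: hd_append)
    then have "conn E x w" unfolding conn_iff_path by (metis last_snoc snoc_eq_iff_butlast)
    then show "w \<in> V" using conn_in_Union[of E x w] edges assms by blast
  qed
  ultimately have pb: "path_between V E x y p"
    using p unfolding path_between_def successively_iff_path_edges by blast
  have "polygons_crossed E k p \<subseteq> separating x y"
  proof
    fix P assume P: "P \<in> polygons_crossed E k p"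
    then obtain e R where "e \<in> P" "e \<in> R" "R \<in> separating x y"
      using p(4) unfolding polygons_crossed_def by blast
    then show "P \<in> separating x y"
      using polygons_disjoint[of P R] P unfolding polygons_crossed_def separating_def by blast
  qed
  then have "polygons_crossed E k p = separating x y" using separating_subset_crossed[OF pb] by blast
  then show "\<exists>p. path_between V E x y p \<and> card (polygons_crossed E k p) = card (separating x y)"
    using pb by auto
next
  fix n assume "\<exists>p. path_between V E x y p \<and> card (polygons_crossed E k p) = n"
  then show "card (separating x y) \<le> n"
    using card_mono[OF finite_polygons_crossed separating_subset_crossed] by auto
qed

lemma pdist_commute: "x \<in> V \<Longrightarrow> y \<in> V \<Longrightarrow> pdist x y = pdist y x"
  by (simp add: pdist_eq_card_separating separating_def eq_commute)

lemma pdist_eq_0_iff: "x \<in> V \<Longrightarrow> y \<in> V \<Longrightarrow> pdist x y = 0 \<longleftrightarrow> x = y"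
proof
  assume a: "x \<in> V" "y \<in> V" "pdist x y = 0"
  then have "separating x y = {}" using finite_separating by (simp add: pdist_eq_card_separating)
  then have "conn {} x y" using conn_separating[OF a(1,2)] by simp
  then show "x = y" using conn_in_Union[of "{}" x y] by simp
qed (simp add: pdist_eq_card_separating separating_def)

text \<open>Moving from the gate to another vertex of \<open>P\<close> changes no gate in other
  polygons, so it adds exactly \<open>P\<close> to the separating set.\<close>

lemma pdist_polygon:
  assumes "P \<in> polys" "x \<in> V" "y \<in> \<Union>P"
  shows "pdist x y = pdist x (gate P x) + (if y = gate P x then 0 else 1)"
proof (cases "y = gate P x")
  case False
  let ?z = "gate P x"
  have z: "?z \<in> \<Union>P" using gate_in_polygon assms by blast
  have V: "y \<in> V" "?z \<in> V" using polygon_vertices assms z by blast+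
  have "gate R y = gate R ?z" if "R \<in> polys" "R \<noteq> P" for R
    using gate_eq_if_other_polygon that assms z by blast
  then have "R \<in> separating x y \<longleftrightarrow> R = P \<or> R \<in> separating x ?z" for R
    using gate_of_vertex[OF assms(1,3)] False assms(1) unfolding separating_def mem_Collect_eq
    by metis
  then have "separating x y = insert P (separating x ?z)" by blast
  moreover have "P \<notin> separating x ?z"
    using gate_of_vertex[OF assms(1) z] unfolding separating_def by simp
  ultimately have "separating x y = insert P (separating x ?z)" "P \<notin> separating x ?z" by blast+
  then show ?thesis using False V assms(2) finite_separating by (simp add: pdist_eq_card_separating)
qed simp

text \<open>With one separating polygon, \<open>conn_separating\<close> yields a walk inside
  it.\<close>

lemma pdist_eq_1D:
  assumes "x \<in> V" "y \<in> V" "pdist x y = 1"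
  obtains P where "P \<in> polys" "x \<in> \<Union>P" "y \<in> \<Union>P"
proof -
  obtain P where P: "separating x y = {P}"
    using assms by (metis card_1_singletonE pdist_eq_card_separating)
  have "conn P x y" using conn_separating[OF assms(1,2)] P by simp
  moreover have "x \<noteq> y" using P unfolding separating_def by auto
  ultimately have "x \<in> \<Union>P" "y \<in> \<Union>P"
    using conn_in_Union[of P x y] conn_in_Union[OF conn_sym, of P x y] by auto
  then show ?thesis using that P unfolding separating_def by blast
qed

end

subsection \<open>Spheres\<close>

locale rooted_graph = polygonal_graph V E k r
  for V :: "'a set" and E :: "'a set set" and k r :: nat +
  fixes b :: 'a
  assumes root: "b \<in> V"
begin

definition sphere :: "nat \<Rightarrow> 'a set" where
  "sphere n = {x \<in> V. pdist x b = n}"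

text \<open>These are the polygons at \<open>x\<close> leading away from the root; at the root, all
  of them.\<close>

definition child_polygons :: "'a \<Rightarrow> 'a set set set" where
  "child_polygons x = {R \<in> polys. x \<in> \<Union>R \<and> gate R b = x}"

lemma sphere_0: "sphere 0 = {b}"
  using root pdist_eq_0_iff unfolding sphere_def by auto

text \<open>If \<open>x\<close> is not the root, exactly one polygon at \<open>x\<close> leads back:
  it exists by \<open>exists_polygon_towards\<close> and is unique by
  \<open>gate_at_shared_vertex\<close>.\<close>

lemma
  assumes "x \<in> V"
  shows finite_child_polygons: "finite (child_polygons x)"
    and card_child_polygons: "card (child_polygons x) = (if x = b then r else r - 1)"
proof -
  let ?A = "{R \<in> polys. x \<in> \<Union>R}"
  have A: "card ?A = r" using card_polygons_at assms by blast
  \<comment> \<open>An infinite set would have cardinality 0, but \<open>r\<close> is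
    positive.\<close>
  then have fin: "finite ?A" using r_ge_2 by (intro card_ge_0_finite) simp
  then show "finite (child_polygons x)" unfolding child_polygons_def by (elim rev_finite_subset) blast
  show "card (child_polygons x) = (if x = b then r else r - 1)"
  proof (cases "x = b")
    case True
    then have "child_polygons x = ?A" unfolding child_polygons_def using gate_of_vertex by auto
    then show ?thesis using A True by simp
  next
    case False
    obtain P where P: "P \<in> polys" "x \<in> \<Union>P" "gate P b \<noteq> x"
      using exists_polygon_towards[OF root assms] False by metis
    have "child_polygons x = ?A - {P}"
      using P gate_at_shared_vertex[of P _ x b] root unfolding child_polygons_def by blast
    then show ?thesis using A P fin False by simp
  qed
qed

lemma pdist_child:
  assumes "R \<in> child_polygons x" "y \<in> \<Union>R - {x}"
  shows "pdist y b = Suc (pdist x b)"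
proof -
  have R: "R \<in> polys" "gate R b = x" "x \<in> \<Union>R" using assms unfolding child_polygons_def by auto
  then have "x \<in> V" "y \<in> V" using polygon_vertices assms by blast+
  then show ?thesis
    using pdist_polygon[OF R(1) root, of y] R assms pdist_commute[OF root] by simp
qed

text \<open>Two different polygons would both lead from \<open>y\<close> to the root.\<close>

lemma child_polygon_unique:
  assumes "R \<in> child_polygons x" "y \<in> \<Union>R - {x}" "R' \<in> child_polygons x'" "y \<in> \<Union>R' - {x'}"
  shows "R = R' \<and> x = x'"
  using gate_at_shared_vertex[of R R' y b] assms root unfolding child_polygons_def by auto

lemma sphere_Suc:
  "sphere (Suc n) = (\<Union>x\<in>sphere n. \<Union>R\<in>child_polygons x. \<Union>R - {x})" (is "_ = ?B")
proof
  show "?B \<subseteq> sphere (Suc n)"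
    using pdist_child polygon_vertices unfolding sphere_def child_polygons_def by fastforce
  show "sphere (Suc n) \<subseteq> ?B"
  proof
    fix y assume "y \<in> sphere (Suc n)"
    then have y: "y \<in> V" "pdist y b = Suc n" unfolding sphere_def by auto
    then have "b \<noteq> y" using pdist_eq_0_iff root by fastforce
    then obtain P where P: "P \<in> polys" "y \<in> \<Union>P" "gate P b \<noteq> y"
      using exists_polygon_towards[OF root y(1)] by metis
    \<comment> \<open>The parent of \<open>y\<close> is the gate of the root in the polygon leading
      from \<open>y\<close> to the root.\<close>
    define x where "x = gate P b"
    have x: "x \<in> \<Union>P" unfolding x_def using gate_in_polygon P root by blast
    then have "P \<in> child_polygons x" using P unfolding child_polygons_def x_def by blast
    moreover have "y \<in> \<Union>P - {x}" using P unfolding x_def by blast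
    moreover have "x \<in> sphere n"
      using pdist_child[OF calculation] y polygon_vertices[OF P(1)] x unfolding sphere_def by auto
    ultimately show "y \<in> ?B" by blast
  qed
qed

lemma finite_sphere: "finite (sphere n)"
proof (induction n)
  case (Suc n)
  show ?case unfolding sphere_Suc
  proof (intro finite_UN_I Suc)
    fix x assume "x \<in> sphere n"
    then show "finite (child_polygons x)" using finite_child_polygons unfolding sphere_def by blast
    fix R assume "R \<in> child_polygons x"
    then show "finite (\<Union>R - {x})" using finite_polygon_vertices unfolding child_polygons_def by blast
  qed
qed (simp add: sphere_0)

text \<open>By \<open>child_polygon_unique\<close> the union in \<open>sphere_Suc\<close> is
  disjoint over the pairs \<open>(x, R)\<close>.\<close>

lemma card_sphere_Suc_filter:
  "card {y \<in> sphere (Suc n). \<phi> y} =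
    (\<Sum>x\<in>sphere n. \<Sum>R\<in>child_polygons x. card {y \<in> \<Union>R - {x}. \<phi> y})"
proof -
  let ?I = "Sigma (sphere n) child_polygons"
  let ?A = "\<lambda>(x, R). {y \<in> \<Union>R - {x}. \<phi> y}"
  have V: "x \<in> V" if "x \<in> sphere n" for x using that unfolding sphere_def by simp
  have "{y \<in> sphere (Suc n). \<phi> y} = (\<Union>i\<in>?I. ?A i)" unfolding sphere_Suc by auto
  also have "card \<dots> = (\<Sum>i\<in>?I. card (?A i))"
  proof (rule card_UN_disjoint)
    show "finite ?I" using finite_sphere finite_child_polygons V by blast
    have "finite (?A (x, R))" if "R \<in> child_polygons x" for x R
      using finite_polygon_vertices[of R] that unfolding child_polygons_def
      by (auto intro: rev_finite_subset simp del: Union_iff)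
    then show "\<forall>i\<in>?I. finite (?A i)" by blast
    show "\<forall>i\<in>?I. \<forall>j\<in>?I. i \<noteq> j \<longrightarrow> ?A i \<inter> ?A j = {}"
    proof (intro ballI impI)
      fix i j assume ij: "i \<in> ?I" "j \<in> ?I" "i \<noteq> j"
      obtain x R x' R' where "i = (x, R)" "j = (x', R')" by (metis surj_pair)
      then show "?A i \<inter> ?A j = {}"
        using ij child_polygon_unique[of R x _ R' x'] by (auto simp del: Union_iff)
    qed
  qed
  also have "\<dots> = (\<Sum>x\<in>sphere n. \<Sum>R\<in>child_polygons x. card {y \<in> \<Union>R - {x}. \<phi> y})"
    using finite_sphere finite_child_polygons V by (subst sum.Sigma) (auto simp: case_prod_unfold simp del: Union_iff)
  finally show ?thesis .
qed

end

subsection \<open>The Busemann function of a ray\<close>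

locale graph_with_ray = rooted_graph V E k r b
  for V :: "'a set" and E :: "'a set set" and k r :: nat and b :: 'a +
  fixes \<omega> :: "nat \<Rightarrow> 'a"
  assumes ray: "\<omega> \<in> boundary V E k b"
begin

lemma ray_in_V [simp]: "\<omega> i \<in> V"
  using ray unfolding boundary_def by blast

lemma ray_0: "\<omega> 0 = b"
  using ray unfolding boundary_def by blast

lemma pdist_ray: "int (pdist (\<omega> i) (\<omega> j)) = \<bar>int i - int j\<bar>"
  using ray unfolding boundary_def by blast

lemma pdist_ray_root: "pdist (\<omega> i) b = i"
  using pdist_ray[of i 0] ray_0 by simp

lemma ray_in_sphere: "\<omega> n \<in> sphere n"
  unfolding sphere_def using pdist_ray_root by simp

text \<open>Consecutive nodes have distance 1 and so share a polygon; it is unique, as two polygons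
  have at most one common vertex.\<close>

definition ray_polygon :: "nat \<Rightarrow> 'a set set" where
  "ray_polygon i = (SOME P. P \<in> polys \<and> \<omega> i \<in> \<Union>P \<and> \<omega> (Suc i) \<in> \<Union>P)"

lemma ray_polygon: "ray_polygon i \<in> polys" "\<omega> i \<in> \<Union>(ray_polygon i)" "\<omega> (Suc i) \<in> \<Union>(ray_polygon i)"
proof -
  have "pdist (\<omega> i) (\<omega> (Suc i)) = 1" using pdist_ray[of i "Suc i"] by simp
  then have "\<exists>P. P \<in> polys \<and> \<omega> i \<in> \<Union>P \<and> \<omega> (Suc i) \<in> \<Union>P"
    using pdist_eq_1D[OF ray_in_V ray_in_V] by metis
  from someI_ex[OF this]
  show "ray_polygon i \<in> polys" "\<omega> i \<in> \<Union>(ray_polygon i)" "\<omega> (Suc i) \<in> \<Union>(ray_polygon i)"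
    unfolding ray_polygon_def by blast+
qed

text \<open>Distances from \<open>x\<close> to vertices of \<open>P\<close> take only two values,
  the smaller one at the gate alone.\<close>

lemma gate_nearer:
  assumes "P \<in> polys" "y \<in> \<Union>P" "z \<in> \<Union>P" "x \<in> V" "pdist x y < pdist x z"
  shows "gate P x = y"
  using pdist_polygon[OF assms(1,4,2)] pdist_polygon[OF assms(1,4,3)] assms(5)
  by (auto split: if_splits)

lemma gate_ray_polygon: "gate (ray_polygon i) (\<omega> m) = (if m \<le> i then \<omega> i else \<omega> (Suc i))"
  using gate_nearer[OF ray_polygon(1) ray_polygon(2) ray_polygon(3), of "\<omega> m" i]
    gate_nearer[OF ray_polygon(1) ray_polygon(3) ray_polygon(2), of "\<omega> m" i]
    pdist_ray[of m i] pdist_ray[of m "Suc i"] by auto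

lemma gate_ray_polygon_root: "gate (ray_polygon i) b = \<omega> i"
  using gate_ray_polygon[of i 0] ray_0 by simp

lemma ray_eq_iff [simp]: "\<omega> i = \<omega> j \<longleftrightarrow> i = j"
  using pdist_ray_root by metis

lemma inj_ray_polygon: "inj ray_polygon"
  by (rule injI) (metis gate_ray_polygon_root ray_eq_iff)

text \<open>The first \<open>m\<close> ray polygons are distinct and separating, and the distance
  \<open>m\<close> leaves room for no others.\<close>

lemma separating_ray: "separating b (\<omega> m) = ray_polygon ` {..<m}"
proof (rule card_subset_eq[symmetric])
  show "finite (separating b (\<omega> m))" using finite_separating root by simp
  show "ray_polygon ` {..<m} \<subseteq> separating b (\<omega> m)"
    unfolding separating_def
    using ray_polygon(1) gate_ray_polygon_root gate_ray_polygon by auto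
  have "card (ray_polygon ` {..<m}) = m"
    by (simp add: card_image inj_on_subset[OF inj_ray_polygon])
  also have "\<dots> = card (separating b (\<omega> m))"
    using pdist_ray[of 0 m] ray_0 root by (simp add: pdist_eq_card_separating)
  finally show "card (ray_polygon ` {..<m}) = card (separating b (\<omega> m))" .
qed

text \<open>Otherwise, going down from \<open>i\<close>, \<open>gate_at_shared_vertex\<close> at
  \<open>\<omega> (Suc j)\<close> puts \<open>x\<close> beyond every earlier ray polygon too. Then
  \<open>i + 1\<close> polygons separate \<open>x\<close> from the root, too many for its
  length.\<close>

lemma gate_ray_polygon_far:
  assumes "x \<in> V" "pdist x b \<le> i"
  shows "gate (ray_polygon i) x = \<omega> i"
proof (rule ccontr)
  assume n: "gate (ray_polygon i) x \<noteq> \<omega> i"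
  have "gate (ray_polygon j) x \<noteq> \<omega> j" if "j \<le> i" for j
    using that
  proof (induction rule: inc_induct)
    case (step j)
    have "ray_polygon j \<noteq> ray_polygon (Suc j)" using inj_ray_polygon by (auto dest: injD)
    then have "gate (ray_polygon j) x = \<omega> (Suc j)"
      using gate_at_shared_vertex[OF ray_polygon(1) ray_polygon(1) _ ray_polygon(3) ray_polygon(2) assms(1)]
        step.IH by blast
    then show ?case by simp
  qed (fact n)
  then have "ray_polygon ` {..i} \<subseteq> separating x b"
    unfolding separating_def using ray_polygon(1) gate_ray_polygon_root by auto
  then have "card (ray_polygon ` {..i}) \<le> pdist x b"
    using assms root by (simp add: pdist_eq_card_separating card_mono finite_separating)
  moreover have "card (ray_polygon ` {..i}) = Suc i"
    by (simp add: card_image inj_on_subset[OF inj_ray_polygon])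
  ultimately show False using assms by simp
qed

text \<open>From index \<open>pdist x b\<close> on, the gate of \<open>x\<close> in each ray polygon
  is its earlier node, so every step along the ray adds one to the distance.\<close>

lemma pdist_ray_far:
  assumes "x \<in> V" "pdist x b \<le> m"
  shows "int m - int (pdist x (\<omega> m)) = int (pdist x b) - int (pdist x (\<omega> (pdist x b)))"
  using assms(2)
proof (induction rule: dec_induct)
  case (step m)
  have "gate (ray_polygon m) x = \<omega> m" using gate_ray_polygon_far assms step by simp
  then have "pdist x (\<omega> (Suc m)) = Suc (pdist x (\<omega> m))"
    using pdist_polygon[OF ray_polygon(1)[of m] assms(1) ray_polygon(3)] by simp
  then show ?case using step by simp
qed simp

abbreviation "bus x \<equiv> busemann V E k b x \<omega>"

text \<open>Equality \<open>m = pdist x b\<close> is allowed, unlike in the definition. Thus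
  \<open>\<omega> (Suc n)\<close> serves both for a vertex of length \<open>n\<close> and for its
  children.\<close>

lemma busemann_eq:
  assumes "x \<in> V" "pdist x b \<le> m"
  shows "bus x = int m - int (pdist x (\<omega> m))"
proof -
  have *: "int (pdist b (\<omega> j)) - int (pdist x (\<omega> j)) = int m - int (pdist x (\<omega> m))"
    if "j > pdist x b" for j
    using pdist_ray_far[OF assms(1), of j] pdist_ray_far[OF assms] that pdist_ray[of 0 j] ray_0 by simp
  show ?thesis
    unfolding busemann_def using *
    by (intro the_equality) (blast, metis lessI)
qed

lemma busemann_ray: "bus (\<omega> n) = int n"
  using busemann_eq[of "\<omega> n" n] pdist_ray_root pdist_ray[of n n] by simp

text \<open>Compare distances to \<open>\<omega> (Suc n)\<close>. This node is its own gate in the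
  ray polygon; in any other child polygon of \<open>x\<close> its gate is \<open>x\<close>, and
  \<open>y\<close> is one step farther away.\<close>

lemma busemann_child:
  assumes "R \<in> child_polygons x" "y \<in> \<Union>R - {x}" "pdist x b = n"
  shows "bus y = (if R = ray_polygon n then if y = \<omega> (Suc n) then int n + 1 else int n
    else bus x - 1)"
proof -
  have R: "R \<in> polys" "gate R b = x" "x \<in> \<Union>R" using assms unfolding child_polygons_def by auto
  have V: "x \<in> V" "y \<in> V" using polygon_vertices R assms by blast+
  let ?w = "\<omega> (Suc n)"
  have busx: "bus x = int (Suc n) - int (pdist ?w x)"
    using busemann_eq[of x "Suc n"] V assms pdist_commute by simp
  have busy: "bus y = int (Suc n) - int (pdist ?w y)"
    using busemann_eq[of y "Suc n"] V pdist_child[OF assms(1,2)] assms pdist_commute by simp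
  note dy = pdist_polygon[OF R(1) ray_in_V[of "Suc n"], of y]
  show ?thesis
  proof (cases "R = ray_polygon n")
    case True
    then have "gate R ?w = ?w" using gate_of_vertex ray_polygon by simp
    then show ?thesis using dy busy True assms pdist_ray[of "Suc n" "Suc n"] by simp
  next
    case False
    \<comment> \<open>A separating \<open>R\<close> would be some \<open>ray_polygon j\<close> with
      \<open>x = \<omega> j\<close>, and the length of \<open>x\<close> forces
      \<open>j = n\<close>.\<close>
    have "R \<notin> separating b ?w"
    proof
      assume "R \<in> separating b ?w"
      then obtain j where j: "R = ray_polygon j" unfolding separating_ray by blast
      then have "x = \<omega> j" using gate_ray_polygon_root R by simp
      then show False using pdist_ray_root assms False j by simp
    qed
    then have "gate R ?w = x" using R unfolding separating_def by auto
    then show ?thesis using dy busy busx assms False by simp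
  qed
qed

lemma ray_polygon_child_iff:
  assumes "x \<in> sphere n"
  shows "ray_polygon n \<in> child_polygons x \<longleftrightarrow> x = \<omega> n"
  using ray_polygon gate_ray_polygon_root unfolding child_polygons_def by auto

subsection \<open>Counting the vertices of a horocycle\<close>

text \<open>The node \<open>\<omega> n\<close> is left out because its children follow a different
  rule; \<open>card_horocycle_sphere\<close> puts it back.\<close>

definition off_ray :: "nat \<Rightarrow> int \<Rightarrow> 'a set" where
  "off_ray n h = {x \<in> sphere n. bus x = h \<and> x \<noteq> \<omega> n}"

text \<open>The terms count children of vertices off the ray, the vertices of
  \<open>ray_polygon n\<close> other than its two nodes, and children of \<open>\<omega> n\<close>
  in its other child polygons. The root has one child polygon more than the later nodes.\<close>

lemma card_off_ray_Suc:
  "card (off_ray (Suc n) h) = (r - 1) * (k - 1) * card (off_ray n (h + 1))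
    + (if h = int n then k - 2 else 0)
    + (if h = int n - 1 then (if n = 0 then r - 1 else r - 2) * (k - 1) else 0)"
proof -
  let ?\<phi> = "\<lambda>y. bus y = h \<and> y \<noteq> \<omega> (Suc n)"
  let ?c = "\<lambda>x R. card {y \<in> \<Union>R - {x}. ?\<phi> y}"
  have V: "x \<in> V" "pdist x b = n" if "x \<in> sphere n" for x using that unfolding sphere_def by auto
  have rp: "ray_polygon n \<in> child_polygons (\<omega> n)"
    using ray_polygon_child_iff[OF ray_in_sphere] by simp
  have off: "?c x R = (if h = bus x - 1 then k - 1 else 0)"
    if "x \<in> sphere n" "R \<in> child_polygons x" "R \<noteq> ray_polygon n" for x R
  proof -
    have R: "R \<in> polys" "x \<in> \<Union>R" using that unfolding child_polygons_def by auto
    have "y \<noteq> \<omega> (Suc n)" if "y \<in> \<Union>R - {x}" for y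
    proof
      assume "y = \<omega> (Suc n)"
      then show False
        using rp child_polygon_unique[OF \<open>R \<in> child_polygons x\<close> that, of "ray_polygon n" "\<omega> n"]
          ray_polygon(3) \<open>R \<noteq> ray_polygon n\<close> by simp
    qed
    moreover have "bus y = bus x - 1" if "y \<in> \<Union>R - {x}" for y
      using busemann_child[OF \<open>R \<in> child_polygons x\<close> that V(2)[OF \<open>x \<in> sphere n\<close>]]
        \<open>R \<noteq> ray_polygon n\<close> by simp
    ultimately have "{y \<in> \<Union>R - {x}. ?\<phi> y} = (if h = bus x - 1 then \<Union>R - {x} else {})"
      by (auto simp del: Union_iff)
    then show ?thesis using R card_polygon_vertices finite_polygon_vertices by auto
  qed
  have on: "?c (\<omega> n) (ray_polygon n) = (if h = int n then k - 2 else 0)"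
  proof -
    define U where "U = \<Union>(ray_polygon n)"
    have "bus y = int n" if "y \<in> U - {\<omega> n, \<omega> (Suc n)}" for y
      using busemann_child[OF rp _ pdist_ray_root, of y] that unfolding U_def by simp
    then have "{y \<in> U - {\<omega> n}. ?\<phi> y} = (if h = int n then U - {\<omega> n, \<omega> (Suc n)} else {})"
      by auto
    moreover have "card (U - {\<omega> n, \<omega> (Suc n)}) = k - 2"
      using ray_polygon[of n] card_polygon_vertices unfolding U_def
      by (subst card_Diff_subset) auto
    ultimately show ?thesis unfolding U_def by simp
  qed
  have x_off: "(\<Sum>R\<in>child_polygons x. ?c x R) = (if bus x = h + 1 then (r - 1) * (k - 1) else 0)"
    if x: "x \<in> sphere n - {\<omega> n}" for x
  proof -
    have "?c x R = (if bus x = h + 1 then k - 1 else 0)" if R: "R \<in> child_polygons x" for R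
    proof -
      have "R \<noteq> ray_polygon n" using R x ray_polygon_child_iff[of x n] by auto
      then have "?c x R = (if h = bus x - 1 then k - 1 else 0)" by (rule off[OF DiffD1[OF x] R])
      also have "h = bus x - 1 \<longleftrightarrow> bus x = h + 1" by linarith
      finally show ?thesis .
    qed
    then have "(\<Sum>R\<in>child_polygons x. ?c x R)
        = (\<Sum>R\<in>child_polygons x. if bus x = h + 1 then k - 1 else 0)"
      by (rule sum.cong[OF refl])
    \<comment> \<open>The root occurs only for \<open>n = 0\<close>, where it is the excluded node;
      so there are \<open>r - 1\<close> child polygons.\<close>
    moreover have "x \<noteq> b"
      using x V[of x] pdist_eq_0_iff[OF root root] ray_0 by auto
    ultimately show ?thesis using card_child_polygons[of x] V x by simp
  qed
  have x_on: "(\<Sum>R\<in>child_polygons (\<omega> n). ?c (\<omega> n) R) = (if h = int n then k - 2 else 0)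
      + (if h = int n - 1 then (if n = 0 then r - 1 else r - 2) * (k - 1) else 0)"
  proof -
    have "(\<Sum>R\<in>child_polygons (\<omega> n). ?c (\<omega> n) R) = ?c (\<omega> n) (ray_polygon n)
        + (\<Sum>R\<in>child_polygons (\<omega> n) - {ray_polygon n}. ?c (\<omega> n) R)"
      using finite_child_polygons rp by (intro sum.remove) auto
    also have "(\<Sum>R\<in>child_polygons (\<omega> n) - {ray_polygon n}. ?c (\<omega> n) R)
        = (\<Sum>R\<in>child_polygons (\<omega> n) - {ray_polygon n}. if h = int n - 1 then k - 1 else 0)"
      using off[OF ray_in_sphere] by (intro sum.cong refl) (simp add: busemann_ray)
    also have "\<dots> = (if h = int n - 1 then (if n = 0 then r - 1 else r - 2) * (k - 1) else 0)"
      using card_child_polygons[of "\<omega> n"] rp finite_child_polygons[of "\<omega> n"] ray_0 ray_eq_iff[of n 0]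
      by auto
    finally show ?thesis using on by simp
  qed
  have "card (off_ray (Suc n) h) = (\<Sum>x\<in>sphere n. \<Sum>R\<in>child_polygons x. ?c x R)"
    unfolding off_ray_def by (rule card_sphere_Suc_filter)
  also have "\<dots> = (\<Sum>R\<in>child_polygons (\<omega> n). ?c (\<omega> n) R)
      + (\<Sum>x\<in>sphere n - {\<omega> n}. \<Sum>R\<in>child_polygons x. ?c x R)"
    using finite_sphere ray_in_sphere by (intro sum.remove) auto
  also have "(\<Sum>x\<in>sphere n - {\<omega> n}. \<Sum>R\<in>child_polygons x. ?c x R)
      = (\<Sum>x\<in>sphere n - {\<omega> n}. if bus x = h + 1 then (r - 1) * (k - 1) else 0)"
    using x_off by (intro sum.cong) auto
  also have "\<dots> = (\<Sum>x | x \<in> sphere n - {\<omega> n} \<and> bus x = h + 1. (r - 1) * (k - 1))"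
    using finite_sphere by (intro sum.inter_filter[symmetric]) simp
  also have "{x. x \<in> sphere n - {\<omega> n} \<and> bus x = h + 1} = off_ray n (h + 1)"
    unfolding off_ray_def by blast
  finally show ?thesis using x_on by simp
qed

text \<open>\<open>n - h\<close> is twice the number of steps from the ray down to the vertex, or one less than
  this number if the first of these steps is along a polygon of the ray.\<close>

lemma card_off_ray:
  "card (off_ray n h) =
    (if int n + h < 0 \<or> int n \<le> h then 0
     else if odd (int n - h) then (k - 2) * ((r - 1) * (k - 1)) ^ nat ((int n - h) div 2)
     else if int n + h = 0 then ((r - 1) * (k - 1)) ^ n
     else (r - 2) * (k - 1) * ((r - 1) * (k - 1)) ^ nat ((int n - h) div 2 - 1))"
proof (induction n arbitrary: h)
  case 0
  have "off_ray 0 h = {}" unfolding off_ray_def using sphere_0 ray_0 by auto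
  then show ?case by auto
next
  case (Suc n)
  let ?q = "(r - 1) * (k - 1)"
  \<comment> \<open>The ray contributes new vertices only for \<open>h = int n\<close> and
    \<open>h = int n - 1\<close>; in the last case the recursion merely multiplies by
    \<open>?q\<close>.\<close>
  consider "int n + 1 + h < 0" | "h \<ge> int n + 1" | "h = int n" | "h = int n - 1"
    | "int n + 1 + h \<ge> 0" "h < int n - 1" by linarith
  then show ?case
  proof cases
    case 5
    define t where "t = (int n - h - 1) div 2"
    have t: "t \<ge> 0" "(int (Suc n) - h) div 2 = t + 1" "(int n - (h + 1)) div 2 = t"
      using 5 unfolding t_def by auto
    have par: "odd (int (Suc n) - h) \<longleftrightarrow> odd (int n - (h + 1))" by auto
    have IH: "card (off_ray n (h + 1)) = (if odd (int (Suc n) - h) then (k - 2) * ?q ^ nat t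
        else if int (Suc n) + h = 0 then ?q ^ n else (r - 2) * (k - 1) * ?q ^ nat (t - 1))"
      unfolding Suc.IH par t(3) using 5 by (simp add: add_ac)
    have rec: "card (off_ray (Suc n) h) = ?q * card (off_ray n (h + 1))"
      using 5 unfolding card_off_ray_Suc by simp
    have pos: "(int (Suc n) + h < 0 \<or> int (Suc n) \<le> h) = False" using 5 by simp
    have pow1: "?q ^ nat (t + 1) = ?q * ?q ^ nat t" using t(1) by (simp add: nat_add_distrib)
    have pow2: "?q ^ nat t = ?q * ?q ^ nat (t - 1)" if "even (int (Suc n) - h)"
    proof -
      \<comment> \<open>Parity raises \<open>int (Suc n) - h\<close> from at least 3 to at least 4,
        so \<open>nat (t - 1)\<close> is not truncated.\<close>
      have "t \<ge> 1" using that 5 unfolding t_def by presburger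
      then have "nat t = Suc (nat (t - 1))" by simp
      then show ?thesis by simp
    qed
    consider "odd (int (Suc n) - h)" | "even (int (Suc n) - h)" "int (Suc n) + h = 0"
      | "even (int (Suc n) - h)" "int (Suc n) + h \<noteq> 0" by blast
    then show ?thesis
    proof cases
      case 1
      show ?thesis unfolding rec IH t(2) pos if_False if_P[OF 1] pow1 by (rule mult.left_commute)
    next
      case 2
      have no: "odd (int (Suc n) - h) = False" using 2(1) by blast
      show ?thesis unfolding rec IH pos no if_False if_P[OF 2(2)] by (rule power_Suc[symmetric])
    next
      case 3
      have no: "odd (int (Suc n) - h) = False" using 3(1) by blast
      show ?thesis unfolding rec IH t(2) pos no if_False if_not_P[OF 3(2)] add_diff_cancel_right' pow2[OF 3(1)]
        by (rule mult.left_commute)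
    qed
  next
    case 3
    then show ?thesis unfolding card_off_ray_Suc Suc.IH by simp
  next
    case 4
    then have "int (Suc n) - h = 2" by simp
    then show ?thesis unfolding card_off_ray_Suc Suc.IH using 4 by simp
  next
    case 1
    then show ?thesis unfolding card_off_ray_Suc Suc.IH by simp
  next
    case 2
    then show ?thesis unfolding card_off_ray_Suc Suc.IH by simp
  qed
qed

lemma card_horocycle_sphere:
  "card {x \<in> sphere n. bus x = h} = card (off_ray n h) + (if h = int n then 1 else 0)"
proof -
  have "{x \<in> sphere n. bus x = h} = off_ray n h \<union> (if h = int n then {\<omega> n} else {})"
    unfolding off_ray_def using ray_in_sphere busemann_ray by auto
  moreover have "\<omega> n \<notin> off_ray n h" "finite (off_ray n h)"
    unfolding off_ray_def using finite_sphere by auto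
  ultimately show ?thesis by (cases "h = int n") simp_all
qed

text \<open>The offset \<open>s\<close> is the negative part of \<open>h\<close>, so
  \<open>h / 2 + s\<close> equals \<open>\<bar>h\<bar> / 2\<close>. This makes the normalised counts
  symmetric in \<open>h\<close>.\<close>

lemma
  fixes h :: int
  defines "a \<equiv> nat \<bar>h\<bar>" and "s \<equiv> if h \<ge> 0 then 0 else nat \<bar>h\<bar>" and "q \<equiv> (r - 1) * (k - 1)"
  shows card_horocycle_sphere_below: "n < a \<Longrightarrow> card {x \<in> sphere n. bus x = h} = 0"
    and card_horocycle_sphere_first: "card {x \<in> sphere a. bus x = h} = q ^ s"
    and card_horocycle_sphere_odd:
      "j \<ge> 1 \<Longrightarrow> card {x \<in> sphere (a + 2 * j - 1). bus x = h} = (k - 2) * q ^ (s + j - 1)"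
    and card_horocycle_sphere_even:
      "j \<ge> 1 \<Longrightarrow> card {x \<in> sphere (a + 2 * j). bus x = h} = (r - 2) * (k - 1) * q ^ (s + j - 1)"
proof -
  show "card {x \<in> sphere n. bus x = h} = 0" if "n < a"
  proof -
    have "int n + h < 0 \<or> int n \<le> h" "h \<noteq> int n" using that unfolding a_def by auto
    then show ?thesis unfolding card_horocycle_sphere card_off_ray by simp
  qed
  show "card {x \<in> sphere a. bus x = h} = q ^ s"
  proof (cases "h \<ge> 0")
    case True
    then have "int a = h" unfolding a_def by simp
    then show ?thesis using True unfolding card_horocycle_sphere card_off_ray s_def by simp
  next
    case False
    then have "int a = - h" "s = a" unfolding a_def s_def by simp_all
    then show ?thesis using False unfolding card_horocycle_sphere card_off_ray q_def by simp
  qed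
  show "card {x \<in> sphere (a + 2 * j - 1). bus x = h} = (k - 2) * q ^ (s + j - 1)" if "j \<ge> 1"
  proof -
    define n where "n = a + 2 * j - 1"
    have n: "int n = \<bar>h\<bar> + 2 * int j - 1" using that unfolding n_def a_def by linarith
    have c: "(int n + h < 0 \<or> int n \<le> h) = False" "(h = int n) = False" using n that by auto
    have o: "odd (int n - h)" unfolding n by (cases "h \<ge> 0") auto
    \<comment> \<open>This uses that \<open>\<bar>h\<bar> - h\<close> equals
      \<open>2 * s\<close>.\<close>
    have "int n - h = 2 * int (s + j - 1) + 1" using n that unfolding s_def by auto
    then have "(int n - h) div 2 = int (s + j - 1)" by simp
    then show ?thesis
      unfolding n_def[symmetric] card_horocycle_sphere card_off_ray c if_False if_P[OF o] q_def by simp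
  qed
  show "card {x \<in> sphere (a + 2 * j). bus x = h} = (r - 2) * (k - 1) * q ^ (s + j - 1)" if "j \<ge> 1"
  proof -
    define n where "n = a + 2 * j"
    have n: "int n = \<bar>h\<bar> + 2 * int j" using that unfolding n_def a_def by linarith
    have c: "(int n + h < 0 \<or> int n \<le> h) = False" "(h = int n) = False" "(int n + h = 0) = False"
      using n that by auto
    have e: "\<not> odd (int n - h)" unfolding n by (cases "h \<ge> 0") auto
    have "int n - h = 2 * (int (s + j - 1) + 1)" using n that unfolding s_def by auto
    then have "(int n - h) div 2 - 1 = int (s + j - 1)" by simp
    then show ?thesis
      unfolding n_def[symmetric] card_horocycle_sphere card_off_ray c if_False if_not_P[OF e] q_def by simp
  qed
qed

subsection \<open>The Abel transform\<close>

lemma radial_eq_radial_value: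
  assumes "radial V E k b f" "x \<in> V"
  shows "f x = radial_value V E k b f (pdist x b)"
  unfolding radial_value_def
proof (rule the_equality[symmetric])
  show "\<forall>y\<in>V. pdist y b = pdist x b \<longrightarrow> f y = f x"
    using assms unfolding radial_def by blast
  show "c = f x" if "\<forall>y\<in>V. pdist y b = pdist x b \<longrightarrow> f y = c" for c
    using that assms(2) by metis
qed

text \<open>The support lies in the ball of radius \<open>L\<close>, where the horocycle splits into
  its finite intersections with spheres.\<close>

lemma infsum_horocycle:
  assumes "radial V E k b f" "\<And>x. x \<in> V \<Longrightarrow> f x \<noteq> 0 \<Longrightarrow> pdist x b \<le> L"
  shows "(\<Sum>\<^sub>\<infinity>x\<in>horocycle V E k b \<omega> h. f x)
    = (\<Sum>n\<le>L. of_nat (card {x \<in> sphere n. bus x = h}) * radial_value V E k b f n)"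
proof -
  let ?A = "\<lambda>n. {x \<in> sphere n. bus x = h}"
  have "(\<Sum>\<^sub>\<infinity>x\<in>horocycle V E k b \<omega> h. f x) = (\<Sum>\<^sub>\<infinity>x\<in>(\<Union>n\<le>L. ?A n). f x)"
  proof (rule infsum_cong_neutral)
    show "f x = 0" if "x \<in> horocycle V E k b \<omega> h - (\<Union>n\<le>L. ?A n)" for x
      using that assms(2)[of x] unfolding horocycle_def sphere_def by auto
    show "f x = 0" if "x \<in> (\<Union>n\<le>L. ?A n) - horocycle V E k b \<omega> h" for x
      using that unfolding horocycle_def sphere_def by auto
  qed simp
  also have "\<dots> = (\<Sum>x\<in>(\<Union>n\<le>L. ?A n). f x)"
    using finite_sphere by (intro infsum_finite) auto
  also have "\<dots> = (\<Sum>n\<le>L. \<Sum>x\<in>?A n. f x)"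
  proof (rule sum.UNION_disjoint)
    show "\<forall>n\<in>{..L}. finite (?A n)" using finite_sphere by simp
    show "\<forall>m\<in>{..L}. \<forall>n\<in>{..L}. m \<noteq> n \<longrightarrow> ?A m \<inter> ?A n = {}"
      unfolding sphere_def by auto
  qed simp
  also have "\<dots> = (\<Sum>n\<le>L. \<Sum>x\<in>?A n. radial_value V E k b f n)"
  proof (intro sum.cong refl)
    fix n x assume "x \<in> ?A n"
    then have "x \<in> V" "pdist x b = n" unfolding sphere_def by simp_all
    then show "f x = radial_value V E k b f n" using radial_eq_radial_value[OF assms(1)] by blast
  qed
  finally show ?thesis by simp
qed

end

section \<open>Summation by parity and the final computation\<close>

lemma infsum_atLeast1_eq_sum:
  assumes "\<And>j. j > L \<Longrightarrow> g j = 0"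
  shows "infsum g {1::nat..} = sum g {1..L}"
proof -
  have "infsum g {1..} = infsum g {1..L}"
  proof (rule infsum_cong_neutral)
    show "g j = 0" if "j \<in> {1..} - {1..L}" for j
      using that by (intro assms) auto
  qed auto
  then show ?thesis by simp
qed

text \<open>With both sums running to \<open>L\<close>, the indices fill
  \<open>{a..a + 2 * L}\<close>; this covers \<open>{a..L}\<close>, and the surplus terms
  vanish.\<close>

lemma sum_split_parity:
  fixes g :: "nat \<Rightarrow> 'b::comm_monoid_add"
  assumes "\<And>n. n < a \<Longrightarrow> g n = 0" "\<And>n. n > L \<Longrightarrow> g n = 0"
  shows "(\<Sum>n\<le>L. g n) = g a + (\<Sum>j=1..L. g (a + 2 * j - 1)) + (\<Sum>j=1..L. g (a + 2 * j))"
proof -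
  have "(\<Sum>n=a..a + 2 * M. g n) = g a + (\<Sum>j=1..M. g (a + 2 * j - 1)) + (\<Sum>j=1..M. g (a + 2 * j))" for M
    by (induction M) (simp_all add: ac_simps)
  moreover have "(\<Sum>n\<le>L. g n) = (\<Sum>n=a..a + 2 * L. g n)"
  proof (rule sum.mono_neutral_cong)
    show "g n = 0" if "n \<in> {a..a + 2 * L} - {..L}" for n
      using that by (intro assms(2)) simp
    show "g n = 0" if "n \<in> {..L} - {a..a + 2 * L}" for n
      using that by (intro assms(1)) auto
  qed simp_all
  ultimately show ?thesis by simp
qed

theorem proposition3p1:
  fixes V :: "'a set" and E :: "'a set set" and k r :: nat and b :: 'a
    and Q \<sigma> :: real and f :: "'a \<Rightarrow> complex" and F :: "nat \<Rightarrow> complex"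
  assumes "k \<ge> 2" and "r \<ge> 2"
    and "symmetric_graph V E k r"
    and "b \<in> V"
    and "Q = (real r - 1) * (real k - 1)" and "\<sigma> = real k - 2"
    and "f \<in> finitely_supported V" and "radial V E k b f"
    and "F = radial_value V E k b f"
  shows "\<forall>\<omega> \<in> boundary V E k b. \<forall>h :: int.
    abel_transform V E k r b f \<omega> h =
      of_real (Q powr (\<bar>real_of_int h\<bar> / 2)) * F (nat \<bar>h\<bar>)
      + of_real \<sigma> * (\<Sum>\<^sub>\<infinity>j\<in>{1::nat..}.
          of_real (Q powr (\<bar>real_of_int h\<bar> / 2 + real j - 1)) * F (nat \<bar>h\<bar> + 2 * j - 1))
      + of_real ((real r - 2) / (real r - 1)) * (\<Sum>\<^sub>\<infinity>j\<in>{1::nat..}.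
          of_real (Q powr (\<bar>real_of_int h\<bar> / 2 + real j)) * F (nat \<bar>h\<bar> + 2 * j))"
proof (intro ballI allI)
  fix \<omega> and h :: int
  assume \<omega>: "\<omega> \<in> boundary V E k b"
  interpret symmetric_graph V E k r by (fact assms(3))
  interpret graph_with_ray V E k r b \<omega> by unfold_locales (fact assms \<omega>)+
  define a where "a = nat \<bar>h\<bar>"
  define s where "s = (if h \<ge> 0 then 0 else nat \<bar>h\<bar>)"
  define c where "c n = card {x \<in> sphere n. bus x = h}" for n
  define q where "q = (r - 1) * (k - 1)"
  have q: "real q = Q" using assms(1,2,5) unfolding q_def by (simp add: of_nat_diff)
  have Q: "Q > 0" using assms(1,2,5) by simp
  have card_below: "c n = 0" if "n < a" for n
    using that card_horocycle_sphere_below unfolding c_def a_def by simp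
  have card_first: "c a = q ^ s"
    unfolding c_def a_def s_def q_def by (rule card_horocycle_sphere_first)
  have card_odd: "c (a + 2 * j - 1) = (k - 2) * q ^ (s + j - 1)" if "j \<ge> 1" for j
    using card_horocycle_sphere_odd[OF that] unfolding c_def a_def s_def q_def by simp
  have card_even: "c (a + 2 * j) = (r - 2) * (k - 1) * q ^ (s + j - 1)" if "j \<ge> 1" for j
    using card_horocycle_sphere_even[OF that] unfolding c_def a_def s_def q_def by simp

  \<comment> \<open>The factor \<open>Q powr (h / 2)\<close> absorbs the offset \<open>s\<close>,
    leaving the exponent \<open>\<bar>h\<bar> / 2\<close>.\<close>
  have pow: "Q powr (h / 2) * real (q ^ (s + i)) = Q powr (\<bar>real_of_int h\<bar> / 2 + real i)" for i
  proof -
    have "Q powr (h / 2) * real (q ^ (s + i)) = Q powr (h / 2 + real (s + i))"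
      using Q q by (simp add: powr_add powr_realpow power_add)
    also have "h / 2 + real (s + i) = \<bar>real_of_int h\<bar> / 2 + real i"
      unfolding s_def by (simp add: field_simps)
    finally show ?thesis .
  qed
  have coeff_odd: "Q powr (h / 2) * real (c (a + 2 * j - 1))
      = \<sigma> * Q powr (\<bar>real_of_int h\<bar> / 2 + real j - 1)" if "j \<ge> 1" for j
  proof -
    have "Q powr (h / 2) * real (c (a + 2 * j - 1)) = \<sigma> * (Q powr (h / 2) * real (q ^ (s + (j - 1))))"
      unfolding card_odd[OF that] using assms(1,6) that by (simp add: of_nat_diff)
    then show ?thesis unfolding pow using that by (simp add: of_nat_diff algebra_simps)
  qed
  have coeff_even: "Q powr (h / 2) * real (c (a + 2 * j))
      = (real r - 2) / (real r - 1) * Q powr (\<bar>real_of_int h\<bar> / 2 + real j)" if "j \<ge> 1" for j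
  proof -
    have "real (c (a + 2 * j)) = (real r - 2) * (real k - 1) * Q ^ (s + j - 1)"
      unfolding card_even[OF that] using assms(1,2) q by (simp add: of_nat_diff)
    \<comment> \<open>Writing \<open>k - 1\<close> as \<open>Q / (r - 1)\<close> produces the
      fraction and raises the exponent by one.\<close>
    also have "\<dots> = (real r - 2) / (real r - 1) * (Q * Q ^ (s + j - 1))"
      using assms(2,5) by simp
    also have "Q * Q ^ (s + j - 1) = Q ^ (s + j)"
      using that by (metis Suc_diff_1 add_gr_0 less_le_trans power_Suc zero_less_one)
    finally have "Q powr (h / 2) * real (c (a + 2 * j))
        = (real r - 2) / (real r - 1) * (Q powr (h / 2) * real (q ^ (s + j)))"
      using q by simp
    then show ?thesis unfolding pow .
  qed

  have "finite {x \<in> V. f x \<noteq> 0}" using assms(7) unfolding finitely_supported_def by simp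
  then have "finite ((\<lambda>x. pdist x b) ` {x \<in> V. f x \<noteq> 0})" by simp
  then obtain L where L: "\<And>x. x \<in> V \<Longrightarrow> f x \<noteq> 0 \<Longrightarrow> pdist x b \<le> L"
    unfolding finite_nat_set_iff_bounded_le by blast
  \<comment> \<open>The ray supplies a vertex of every length \<open>n\<close>, so the description
    defining \<open>F n\<close> has a unique solution.\<close>
  have F0: "F n = 0" if "n > L" for n
    using radial_eq_radial_value[OF assms(8) ray_in_V, of n] pdist_ray_root[of n] L[OF ray_in_V, of n]
      that assms(9) by fastforce

  let ?T = "of_real (Q powr (h / 2)) :: complex"
  have inf: "(\<Sum>\<^sub>\<infinity>x\<in>horocycle V E k b \<omega> h. f x) = (\<Sum>n\<le>L. of_nat (c n) * F n)"
    unfolding c_def assms(9) using L by (intro infsum_horocycle assms(8))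
  have "abel_transform V E k r b f \<omega> h = ?T * (\<Sum>n\<le>L. of_nat (c n) * F n)"
    unfolding abel_transform_def inf assms(5) ..
  also have "(\<Sum>n\<le>L. of_nat (c n) * F n) = of_nat (c a) * F a
      + (\<Sum>j=1..L. of_nat (c (a + 2 * j - 1)) * F (a + 2 * j - 1))
      + (\<Sum>j=1..L. of_nat (c (a + 2 * j)) * F (a + 2 * j))"
    by (rule sum_split_parity) (simp_all add: card_below F0)
  also have "?T * \<dots> = of_real (Q powr (h / 2) * real (c a)) * F a
      + (\<Sum>j=1..L. of_real (Q powr (h / 2) * real (c (a + 2 * j - 1))) * F (a + 2 * j - 1))
      + (\<Sum>j=1..L. of_real (Q powr (h / 2) * real (c (a + 2 * j))) * F (a + 2 * j))"
    by (simp add: distrib_left sum_distrib_left mult.assoc)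
  also have "Q powr (h / 2) * real (c a) = Q powr (\<bar>real_of_int h\<bar> / 2)"
    using pow[of 0] card_first by simp
  also have "(\<Sum>j=1..L. of_real (Q powr (h / 2) * real (c (a + 2 * j - 1))) * F (a + 2 * j - 1))
      = of_real \<sigma> * (\<Sum>j=1..L. of_real (Q powr (\<bar>real_of_int h\<bar> / 2 + real j - 1)) * F (a + 2 * j - 1))"
    unfolding sum_distrib_left by (intro sum.cong refl) (simp only: coeff_odd atLeastAtMost_iff of_real_mult mult.assoc)
  also have "(\<Sum>j=1..L. of_real (Q powr (\<bar>real_of_int h\<bar> / 2 + real j - 1)) * F (a + 2 * j - 1))
      = (\<Sum>\<^sub>\<infinity>j\<in>{1::nat..}. of_real (Q powr (\<bar>real_of_int h\<bar> / 2 + real j - 1)) * F (a + 2 * j - 1))"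
    by (rule infsum_atLeast1_eq_sum[symmetric]) (simp add: F0)
  also have "(\<Sum>j=1..L. of_real (Q powr (h / 2) * real (c (a + 2 * j))) * F (a + 2 * j))
      = of_real ((real r - 2) / (real r - 1))
        * (\<Sum>j=1..L. of_real (Q powr (\<bar>real_of_int h\<bar> / 2 + real j)) * F (a + 2 * j))"
    unfolding sum_distrib_left by (intro sum.cong refl) (simp only: coeff_even atLeastAtMost_iff of_real_mult mult.assoc)
  also have "(\<Sum>j=1..L. of_real (Q powr (\<bar>real_of_int h\<bar> / 2 + real j)) * F (a + 2 * j))
      = (\<Sum>\<^sub>\<infinity>j\<in>{1::nat..}. of_real (Q powr (\<bar>real_of_int h\<bar> / 2 + real j)) * F (a + 2 * j))"
    by (rule infsum_atLeast1_eq_sum[symmetric]) (simp add: F0)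
  finally show "abel_transform V E k r b f \<omega> h =
      of_real (Q powr (\<bar>real_of_int h\<bar> / 2)) * F (nat \<bar>h\<bar>)
      + of_real \<sigma> * (\<Sum>\<^sub>\<infinity>j\<in>{1::nat..}.
          of_real (Q powr (\<bar>real_of_int h\<bar> / 2 + real j - 1)) * F (nat \<bar>h\<bar> + 2 * j - 1))
      + of_real ((real r - 2) / (real r - 1)) * (\<Sum>\<^sub>\<infinity>j\<in>{1::nat..}.
          of_real (Q powr (\<bar>real_of_int h\<bar> / 2 + real j)) * F (nat \<bar>h\<bar> + 2 * j))"
    unfolding a_def .
qed

end
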